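(* Let $J=\mathrm{diag}(1,-1,1,-1,1)$, let $a\in\mathbb{R}$, $b_1,b_2,b_3,b_4\in\mathbb{C}$, and let $A\in M_5(\mathbb{C})$ be the tridiagonal matrix with main diagonal $(a,-a,a,-a,a)$, first upper diagonal $(b_1,b_2,b_3,b_4)$ and first lower diagonal $(b_4,b_3,b_2,b_1)$. Let $$\Delta_1=a^2+b_1b_4,\qquad M_1=2a^2-|b_1|^2-|b_4|^2,$$ $$\Delta_2=\Delta_1+2b_2b_3,\qquad M_2=M_1-2|b_2|^2-2|b_3|^2,$$ and, for $k=1,2$, let $\mathcal H_k$ be the hyperbola with foci $\pm\sqrt{\Delta_k}$ and non-transverse axis of length $(2|\Delta_k|-M_k)^{1/2}$. Then $W^J(A)$ is bounded by the nondegenerate hyperbola $\mathcal H_2$ if and only if $|M_2|<2|\Delta_2|$. In this case, $C^J(A)$ consists of the point $a$ and the hyperbolas $\mathcal H_1$ and $\mathcal H_2$, where $\mathcal H_1$ may possibly degenerate into the pair of points $\pm\sqrt{\Delta_1}$.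
   Context: For a real diagonal matrix $J\in M_n(\mathbb{C})$ with diagonal entries $\pm1$, put $[x,y]_J=y^*Jx$ for $x,y\in\mathbb{C}^n$. For $A\in M_n(\mathbb{C})$ the $J$-adjoint is $A^\#=JA^*J$. The Krein space numerical range of $A$ is $W^J(A)=W^J_+(A)\cup(-W^J_-(A))\subset\mathbb{C}$, where $W^J_\pm(A)=\{[Ax,x]_J: x\in\mathbb{C}^n,\ [x,x]_J=\pm1\}$ and $-W^J_-(A)=\{-z: z\in W^J_-(A)\}$. Put $\Re^J(A)=\frac{A+A^\#}{2}$ and $\Im^J(A)=\frac{A-A^\#}{2i}$. The boundary generating curve of $W^J(A)$ is the algebraic curve given in homogeneous line coordinates $(u:v:w)$ by $\det(u\,\Re^J(A)+v\,\Im^J(A)+w\,I_n)=0$, i.e. the curve whose tangent lines are the lines $ux+vy+w=0$ with $(u:v:w)$ satisfying this equation (the dual of the curve defined by this equation). $C^J(A)\subset\mathbb{R}^2\cong\mathbb{C}$ denotes its real part. A factor of the determinant proportional to $\alpha u+\beta v+w$ ($\alpha,\beta\in\mathbb{R}$) contributes the point $\alpha+i\beta$ to $C^J(A)$; an irreducible quadratic factor contributes the corresponding dual conic. A nondegenerate hyperbola has transverse and non-transverse axes of (full) positive lengths $2\tilde a$, $2\tilde b$, with half the focal distance equal to $(\tilde a^2+\tilde b^2)^{1/2}$; a hyperbola whose non-transverse axis has length $0$ is regarded as degenerating to its pair of foci. "$W^J(A)$ is bounded by the nondegenerate hyperbola $\mathcal H$" means that $W^J(A)$ is the hyperbolic disc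 consisting of $\mathcal H$ together with the two open convex regions bounded by its branches (the regions containing the foci), so that $\partial W^J(A)=\mathcal H$. *)

theory Defs
  imports "HOL-Analysis.Analysis" "HOL-Computational_Algebra.Polynomial"
begin

section \<open>Krein space numerical range\<close>

definition diagonal_matrix :: "complex ^ 'n \<Rightarrow> complex ^ 'n ^ 'n" where
  "diagonal_matrix d = (\<chi> i j. if i = j then d $ i else 0)"

definition conj_transpose :: "complex ^ 'n ^ 'n \<Rightarrow> complex ^ 'n ^ 'n" where
  "conj_transpose A = (\<chi> i j. cnj (A $ j $ i))"

definition krein_form :: "complex ^ 'n ^ 'n \<Rightarrow> complex ^ 'n \<Rightarrow> complex ^ 'n \<Rightarrow> complex" where
  "krein_form J x y = (\<Sum>i\<in>UNIV. cnj (y $ i) * (J *v x) $ i)"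

definition krein_adjoint :: "complex ^ 'n ^ 'n \<Rightarrow> complex ^ 'n ^ 'n \<Rightarrow> complex ^ 'n ^ 'n" where
  "krein_adjoint J A = J ** conj_transpose A ** J"

definition krein_range_pos :: "complex ^ 'n ^ 'n \<Rightarrow> complex ^ 'n ^ 'n \<Rightarrow> complex set" where
  "krein_range_pos J A = {krein_form J (A *v x) x | x. krein_form J x x = 1}"

definition krein_range_neg :: "complex ^ 'n ^ 'n \<Rightarrow> complex ^ 'n ^ 'n \<Rightarrow> complex set" where
  "krein_range_neg J A = {krein_form J (A *v x) x | x. krein_form J x x = -1}"

definition krein_range :: "complex ^ 'n ^ 'n \<Rightarrow> complex ^ 'n ^ 'n \<Rightarrow> complex set" where
  "krein_range J A = krein_range_pos J A \<union> uminus ` krein_range_neg J A"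

definition krein_Re :: "complex ^ 'n ^ 'n \<Rightarrow> complex ^ 'n ^ 'n \<Rightarrow> complex ^ 'n ^ 'n" where
  "krein_Re J A = (\<chi> i j. (A $ i $ j + krein_adjoint J A $ i $ j) / 2)"

definition krein_Im :: "complex ^ 'n ^ 'n \<Rightarrow> complex ^ 'n ^ 'n \<Rightarrow> complex ^ 'n ^ 'n" where
  "krein_Im J A = (\<chi> i j. (A $ i $ j - krein_adjoint J A $ i $ j) / (2 * \<i>))"


section \<open>Polynomials in the line coordinates\<close>

text \<open>The polynomial ring in \<open>u, v, w\<close> over the complex numbers is rendered as the iterated
  univariate polynomial ring, with \<open>u\<close> the innermost and \<open>w\<close> the outermost variable.\<close>

type_synonym poly3 = "complex poly poly poly"

definition const3 :: "complex \<Rightarrow> poly3" where "const3 c = [:[:[:c:]:]:]"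
definition varU :: poly3 where "varU = [:[:[:0, 1:]:]:]"
definition varV :: poly3 where "varV = [:[:0, 1:]:]"
definition varW :: poly3 where "varW = [:0, 1:]"

definition eval3 :: "poly3 \<Rightarrow> complex \<Rightarrow> complex \<Rightarrow> complex \<Rightarrow> complex" where
  "eval3 q u v w = poly (poly (poly q [:[:w:]:]) [:v:]) u"

definition diffU :: "poly3 \<Rightarrow> poly3" where "diffU q = map_poly (map_poly pderiv) q"
definition diffV :: "poly3 \<Rightarrow> poly3" where "diffV q = map_poly pderiv q"
definition diffW :: "poly3 \<Rightarrow> poly3" where "diffW q = pderiv q"

definition grad3 :: "poly3 \<Rightarrow> complex \<times> complex \<times> complex \<Rightarrow> complex \<times> complex \<times> complex" where
  "grad3 q = (\<lambda>(u, v, w). (eval3 (diffU q) u v w, eval3 (diffV q) u v w, eval3 (diffW q) u v w))"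


section \<open>Boundary generating curve\<close>

definition line_polynomial :: "complex ^ 'n ^ 'n \<Rightarrow> complex ^ 'n ^ 'n \<Rightarrow> poly3" where
  "line_polynomial J A =
     det (\<chi> i j. varU * const3 (krein_Re J A $ i $ j) + varV * const3 (krein_Im J A $ i $ j)
                 + (if i = j then varW else 0))"

text \<open>Affine cone over the dual of the irreducible plane curve \<open>q = 0\<close>. The tangent line of
  \<open>q = 0\<close> at a smooth point \<open>P\<close> is the point of the dual plane with homogeneous coordinates
  \<open>grad3 q P\<close>, and the dual curve is the closure of the set of these points. The closure of this
  constructible set in the usual topology of the complex projective plane agrees with its Zariski
  closure, and it may be taken on the affine cone as long as the origin is ignored.\<close>

definition dual_cone :: "poly3 \<Rightarrow> (complex \<times> complex \<times> complex) set" where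
  "dual_cone q = closure {(c * X, c * Y, c * Z) | c X Y Z u v w.
      c \<noteq> 0 \<and> (u, v, w) \<noteq> (0, 0, 0) \<and> eval3 q u v w = 0
      \<and> grad3 q (u, v, w) = (X, Y, Z) \<and> (X, Y, Z) \<noteq> (0, 0, 0)}"

definition dual_real_part :: "poly3 \<Rightarrow> complex set" where
  "dual_real_part q = {z. (complex_of_real (Re z), complex_of_real (Im z), 1) \<in> dual_cone q}"

text \<open>The dual is taken component by component, so that repeated factors of the determinant
  (along which its gradient vanishes) contribute the dual of their reduced curve. For an
  irreducible linear factor proportional to \<open>\<alpha> u + \<beta> v + w\<close> with \<open>\<alpha>, \<beta>\<close> real the gradient is
  proportional to \<open>(\<alpha>, \<beta>, 1)\<close>, so that it contributes the point \<open>\<alpha> + \<i> \<beta>\<close>. Irreducibility is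
  over the complex numbers.\<close>

definition boundary_generating_curve ::
    "complex ^ 'n ^ 'n \<Rightarrow> complex ^ 'n ^ 'n \<Rightarrow> complex set" where
  "boundary_generating_curve J A =
     \<Union> {dual_real_part q | q. irreducible q \<and> q dvd line_polynomial J A}"


section \<open>Hyperbolas\<close>

text \<open>A hyperbola is given by its foci \<open>f, g\<close> and the full length \<open>l\<close> of its non-transverse axis.
  If the full length of the transverse axis is \<open>t\<close>, half the focal distance is
  \<open>sqrt ((t/2)\<^sup>2 + (l/2)\<^sup>2)\<close>, whence the formula for \<open>t\<close>. For \<open>l = 0\<close> the focal equation would
  describe two rays; the hyperbola is then, by convention, the pair of its foci.\<close>

definition transverse_length :: "complex \<Rightarrow> complex \<Rightarrow> real \<Rightarrow> real" where
  "transverse_length f g l = sqrt ((dist f g)\<^sup>2 - l\<^sup>2)"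

definition hyperbola :: "complex \<Rightarrow> complex \<Rightarrow> real \<Rightarrow> complex set" where
  "hyperbola f g l =
     (if l = 0 then {f, g} else {z. \<bar>dist z f - dist z g\<bar> = transverse_length f g l})"

definition nondegenerate_hyperbola :: "complex \<Rightarrow> complex \<Rightarrow> real \<Rightarrow> bool" where
  "nondegenerate_hyperbola f g l \<longleftrightarrow> l > 0 \<and> transverse_length f g l > 0"

definition degenerate_hyperbola :: "complex \<Rightarrow> complex \<Rightarrow> real \<Rightarrow> bool" where
  "degenerate_hyperbola f g l \<longleftrightarrow> l = 0 \<and> f \<noteq> g"

definition hyperbolic_disc :: "complex \<Rightarrow> complex \<Rightarrow> real \<Rightarrow> complex set" where
  "hyperbolic_disc f g l = hyperbola f g l
     \<union> connected_component_set (- hyperbola f g l) f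
     \<union> connected_component_set (- hyperbola f g l) g"

definition bounded_by_hyperbola :: "complex set \<Rightarrow> complex \<Rightarrow> complex \<Rightarrow> real \<Rightarrow> bool" where
  "bounded_by_hyperbola S f g l \<longleftrightarrow> nondegenerate_hyperbola f g l \<and> S = hyperbolic_disc f g l"

end

theory Submission
  imports Defs "HOL-Computational_Algebra.Polynomial_Factorial" "HOL-Computational_Algebra.Field_as_Ring"
begin

text \<open>Since the matrix commutes with the flip of the coordinates, its line polynomial is
  \<open>(a u + w) (w\<^sup>2 - Q\<^sub>1) (w\<^sup>2 - Q\<^sub>2)\<close> with
  \<open>Q\<^sub>k(u, v) = (u\<^sup>2 + v\<^sup>2) M\<^sub>k / 4 + Re ((u - \<i> v)\<^sup>2 \<Delta>\<^sub>k) / 2\<close>.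
  The form \<open>Q\<^sub>k\<close> has the eigenvalues \<open>M\<^sub>k / 4 \<plusminus> \<bar>\<Delta>\<^sub>k\<bar> / 2\<close>, so for \<open>\<bar>M\<^sub>k\<bar> < 2 \<bar>\<Delta>\<^sub>k\<bar>\<close> the dual of
  \<open>w\<^sup>2 = Q\<^sub>k\<close> is the hyperbola with foci \<open>\<plusminus>\<surd>\<Delta>\<^sub>k\<close>; unique factorisation identifies the components.
  A vector with positive part \<open>p\<close> and negative part \<open>n\<close> has the value
  \<open>a (\<bar>p\<bar>\<^sup>2 + \<bar>n\<bar>\<^sup>2) + \<zeta>\<close>, where Cauchy-Schwarz confines \<open>\<zeta>\<close> to an ellipse of size \<open>2 \<bar>p\<bar> \<bar>n\<bar>\<close> with
  support function determined by \<open>Q\<^sub>2\<close>. The flip-invariant vectors already fill these ellipses, whose union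
  over all admissible \<open>\<bar>p\<bar>, \<bar>n\<bar>\<close> is the hyperbolic disc.\<close>

section \<open>Vectors and matrices of size five\<close>

lemma exhaust_5: "(x::5) = 1 \<or> x = 2 \<or> x = 3 \<or> x = 4 \<or> x = 5"
proof (induct x)
  case (of_int z)
  then have "z = 0 \<or> z = 1 \<or> z = 2 \<or> z = 3 \<or> z = 4" by fastforce
  then show ?case by auto
qed

lemma UNIV_5: "(UNIV::5 set) = {1, 2, 3, 4, 5}"
  using exhaust_5 by auto

lemma sum_5: "sum f (UNIV::5 set) = f 1 + f 2 + f 3 + f 4 + f 5"
  unfolding UNIV_5 by (simp add: ac_simps)

lemma vector_5:
  fixes p q r s t :: "'a::zero"
  shows "(vector [p,q,r,s,t] :: 'a^5) $ 1 = p" "(vector [p,q,r,s,t] :: 'a^5) $ 2 = q"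
    "(vector [p,q,r,s,t] :: 'a^5) $ 3 = r" "(vector [p,q,r,s,t] :: 'a^5) $ 4 = s"
    "(vector [p,q,r,s,t] :: 'a^5) $ 5 = t"
  unfolding vector_def by simp_all

text \<open>Only products of disjoint transpositions of neighbouring indices survive, so there is
  one term for each matching of the path 1-2-3-4-5, the empty one included.\<close>

lemma det_tridiagonal_5:
  fixes A :: "'a::comm_ring_1^5^5"
  assumes "A$1$3 = 0" "A$1$4 = 0" "A$1$5 = 0" "A$2$4 = 0" "A$2$5 = 0" "A$3$5 = 0"
    "A$3$1 = 0" "A$4$1 = 0" "A$5$1 = 0" "A$4$2 = 0" "A$5$2 = 0" "A$5$3 = 0"
  shows "det A = A$1$1 * A$2$2 * A$3$3 * A$4$4 * A$5$5
    - A$1$2 * A$2$1 * A$3$3 * A$4$4 * A$5$5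
    - A$1$1 * A$2$3 * A$3$2 * A$4$4 * A$5$5
    - A$1$1 * A$2$2 * A$3$4 * A$4$3 * A$5$5
    - A$1$1 * A$2$2 * A$3$3 * A$4$5 * A$5$4
    + A$1$2 * A$2$1 * A$3$4 * A$4$3 * A$5$5
    + A$1$2 * A$2$1 * A$3$3 * A$4$5 * A$5$4
    + A$1$1 * A$2$3 * A$3$2 * A$4$5 * A$5$4"
proof -
  have f: "finite {2::5, 3, 4, 5}" "1 \<notin> {2::5, 3, 4, 5}" "finite {3::5, 4, 5}" "2 \<notin> {3::5, 4, 5}"
    "finite {4::5, 5}" "3 \<notin> {4::5, 5}" "finite {5::5}" "4 \<notin> {5::5}"
    by auto
  show ?thesis
    unfolding det_def UNIV_5
    unfolding sum_over_permutations_insert[OF f(1,2)]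
    unfolding sum_over_permutations_insert[OF f(3,4)]
    unfolding sum_over_permutations_insert[OF f(5,6)]
    unfolding sum_over_permutations_insert[OF f(7,8)]
    unfolding permutes_sing
    by (simp add: assms sign_swap_id permutation_swap_id sign_compose permutation_compose sign_id swap_id_eq)
qed

section \<open>Hyperbolas as quadratic regions\<close>

text \<open>Squaring away the roots in the focal equation with foci \<open>\<plusminus>\<surd>D\<close> leaves a quadratic form in \<open>z\<close>.\<close>

definition focal_form :: "complex \<Rightarrow> real \<Rightarrow> complex \<Rightarrow> real" where
  "focal_form D M z = 8 * Re ((cnj z)\<^sup>2 * D) - 4 * M * (cmod z)\<^sup>2"

text \<open>Parallelogram law, with |z - f| |z + f| = |z^2 - f^2| for the cross term. The foci enter
  only through f^2, so the choice of the square root is immaterial.\<close>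

lemma focal_difference_square:
  "(dist z f - dist z (- f))\<^sup>2 = 2 * (cmod z)\<^sup>2 + 2 * cmod (f\<^sup>2) - 2 * cmod (z\<^sup>2 - f\<^sup>2)"
proof -
  have "cmod (z - f) * cmod (z + f) = cmod (z\<^sup>2 - f\<^sup>2)"
    by (simp add: norm_mult[symmetric] power2_eq_square algebra_simps)
  moreover have "(cmod (z - f))\<^sup>2 + (cmod (z + f))\<^sup>2 = 2 * (cmod z)\<^sup>2 + 2 * (cmod f)\<^sup>2"
    by (simp only: cmod_power2) (simp add: power2_eq_square algebra_simps)
  ultimately show ?thesis
    by (simp add: dist_norm power2_diff norm_power)
qed

lemma cmod_diff_square_power2:
  "4 * (cmod (z\<^sup>2 - D))\<^sup>2 = 4 * (cmod z)^4 - 8 * Re ((cnj z)\<^sup>2 * D) + 4 * (cmod D)\<^sup>2"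
proof -
  have "(cmod z)^4 = ((cmod z)\<^sup>2)\<^sup>2" by simp
  then show ?thesis
    by (simp only: cmod_power2) (simp add: power2_eq_square algebra_simps)
qed

text \<open>The condition is squared twice: first it becomes \<open>2 * P \<le> s\<close> (or
  equality), then a quadratic condition on \<open>z\<close>. The second squaring can be undone only
  for nonnegative \<open>s\<close>, which the bound on \<open>M\<close> guarantees.\<close>

lemma focal_difference_compare:
  assumes f: "f\<^sup>2 = D" and M: "\<bar>M\<bar> < 2 * cmod D"
  shows "sqrt (2 * cmod D + M) \<le> \<bar>dist z f - dist z (- f)\<bar> \<longleftrightarrow> 4 * (cmod D)\<^sup>2 - M\<^sup>2 \<le> focal_form D M z"
    and "\<bar>dist z f - dist z (- f)\<bar> = sqrt (2 * cmod D + M) \<longleftrightarrow> focal_form D M z = 4 * (cmod D)\<^sup>2 - M\<^sup>2"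
proof -
  define P where "P = cmod (z\<^sup>2 - D)"
  define s where "s = 2 * (cmod z)\<^sup>2 - M"
  have sq: "\<bar>dist z f - dist z (- f)\<bar>\<^sup>2 - (2 * cmod D + M) = s - 2 * P"
    using focal_difference_square[of z f] f by (simp add: P_def s_def)
  have form: "s\<^sup>2 - (2 * P)\<^sup>2 = focal_form D M z - (4 * (cmod D)\<^sup>2 - M\<^sup>2)"
    using cmod_diff_square_power2[of z D]
    by (simp add: P_def s_def focal_form_def power2_eq_square power4_eq_xxxx algebra_simps)
  have P: "P \<ge> 0" by (simp add: P_def)
  \<comment> \<open>The form is at most 4 |z|^2 (2 |D| - M), so 4 |z|^2 is at least 2 |D| + M,
    whence 2 s is at least 2 |D| - M > 0.\<close>
  have s: "s > 0" if "4 * (cmod D)\<^sup>2 - M\<^sup>2 \<le> focal_form D M z"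
  proof -
    have "Re ((cnj z)\<^sup>2 * D) \<le> (cmod z)\<^sup>2 * cmod D"
      using complex_Re_le_cmod[of "(cnj z)\<^sup>2 * D"] by (simp add: norm_mult norm_power)
    then have "focal_form D M z \<le> 4 * (cmod z)\<^sup>2 * (2 * cmod D - M)"
      by (simp add: focal_form_def algebra_simps)
    with that have "(2 * cmod D - M) * (2 * cmod D + M) \<le> (2 * cmod D - M) * (4 * (cmod z)\<^sup>2)"
      by (simp add: power2_eq_square algebra_simps)
    then have "2 * cmod D + M \<le> 4 * (cmod z)\<^sup>2" by (rule mult_left_le_imp_le) (use M in simp)
    with M show ?thesis by (simp add: s_def)
  qed
  have pos: "2 * cmod D + M > 0" using M by simp
  have "sqrt (2 * cmod D + M) \<le> \<bar>dist z f - dist z (- f)\<bar> \<longleftrightarrow> 2 * cmod D + M \<le> \<bar>dist z f - dist z (- f)\<bar>\<^sup>2"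
    by (auto intro: real_le_lsqrt dest: sqrt_le_D)
  also have "\<dots> \<longleftrightarrow> 2 * P \<le> s" using sq by linarith
  also have "\<dots> \<longleftrightarrow> 4 * (cmod D)\<^sup>2 - M\<^sup>2 \<le> focal_form D M z"
  proof
    assume "2 * P \<le> s"
    then have "(2 * P)\<^sup>2 \<le> s\<^sup>2" by (rule power_mono) (use P in simp)
    then show "4 * (cmod D)\<^sup>2 - M\<^sup>2 \<le> focal_form D M z" using form by linarith
  next
    assume *: "4 * (cmod D)\<^sup>2 - M\<^sup>2 \<le> focal_form D M z"
    then have "(2 * P)\<^sup>2 \<le> s\<^sup>2" using form by linarith
    then show "2 * P \<le> s" by (rule power2_le_imp_le) (use s[OF *] in simp)
  qed
  finally show "sqrt (2 * cmod D + M) \<le> \<bar>dist z f - dist z (- f)\<bar> \<longleftrightarrow> 4 * (cmod D)\<^sup>2 - M\<^sup>2 \<le> focal_form D M z" .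
  have "\<bar>dist z f - dist z (- f)\<bar> = sqrt (2 * cmod D + M) \<longleftrightarrow> \<bar>dist z f - dist z (- f)\<bar>\<^sup>2 = 2 * cmod D + M"
  proof
    assume "\<bar>dist z f - dist z (- f)\<bar> = sqrt (2 * cmod D + M)"
    then show "\<bar>dist z f - dist z (- f)\<bar>\<^sup>2 = 2 * cmod D + M"
      using real_sqrt_pow2[of "2 * cmod D + M"] pos by simp
  next
    assume "\<bar>dist z f - dist z (- f)\<bar>\<^sup>2 = 2 * cmod D + M"
    then show "\<bar>dist z f - dist z (- f)\<bar> = sqrt (2 * cmod D + M)"
      by (rule real_sqrt_unique[symmetric]) simp
  qed
  also have "\<dots> \<longleftrightarrow> 2 * P = s" using sq by linarith
  also have "\<dots> \<longleftrightarrow> focal_form D M z = 4 * (cmod D)\<^sup>2 - M\<^sup>2"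
  proof
    assume "2 * P = s"
    then show "focal_form D M z = 4 * (cmod D)\<^sup>2 - M\<^sup>2" using form by simp
  next
    assume *: "focal_form D M z = 4 * (cmod D)\<^sup>2 - M\<^sup>2"
    then have "(2 * P)\<^sup>2 = s\<^sup>2" using form by linarith
    then show "2 * P = s" by (rule power2_eq_imp_eq) (use P s * in simp_all)
  qed
  finally show "\<bar>dist z f - dist z (- f)\<bar> = sqrt (2 * cmod D + M) \<longleftrightarrow> focal_form D M z = 4 * (cmod D)\<^sup>2 - M\<^sup>2" .
qed

text \<open>The region is star-shaped about \<open>f\<close>: a step towards \<open>f\<close>
  shortens the distance to \<open>f\<close> by its full length and that to \<open>g\<close> by at
  most as much. Conversely, the difference of the distances is continuous and omits the value
  \<open>t\<close> on the component, so it stays above \<open>t\<close>.\<close>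

lemma connected_component_focal_region:
  fixes f g :: complex
  assumes "0 < t" "t < dist f g"
  shows "connected_component_set (- {z. \<bar>dist z f - dist z g\<bar> = t}) f = {z. dist z g - dist z f > t}"
proof
  let ?H = "- {z. \<bar>dist z f - dist z g\<bar> = t}" and ?R = "{z. dist z g - dist z f > t}"
  have "starlike ?R"
    unfolding starlike_def
  proof (intro bexI ballI subsetI)
    fix z w assume z: "z \<in> ?R" and "w \<in> closed_segment f z"
    then have "dist f z = dist f w + dist w z" by (simp add: between_mem_segment[symmetric] between)
    moreover have "dist z g \<le> dist z w + dist w g" by (rule dist_triangle)
    ultimately show "w \<in> ?R" using z by (simp add: dist_commute)
  qed (use assms in simp)
  then have "connected ?R" by (rule starlike_imp_connected)
  moreover have "f \<in> ?R" using assms by simp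
  moreover have "?R \<subseteq> ?H" using assms by auto
  ultimately show "?R \<subseteq> connected_component_set ?H f"
    by (intro connected_component_maximal)
  show "connected_component_set ?H f \<subseteq> ?R"
  proof
    let ?C = "connected_component_set ?H f" and ?d = "\<lambda>z. dist z g - dist z f"
    fix z assume z: "z \<in> ?C"
    have "connected (?d ` ?C)"
      by (intro connected_continuous_image continuous_intros connected_connected_component)
    moreover have "f \<in> ?C" using assms by (simp add: connected_component_refl_eq)
    then have "?d f \<in> ?d ` ?C" by blast
    moreover have "?d z \<in> ?d ` ?C" using z by blast
    moreover have "t \<notin> ?d ` ?C"
    proof
      assume "t \<in> ?d ` ?C"
      then obtain w where "w \<in> ?C" "t = ?d w" by blast
      moreover from this have "w \<in> ?H" using connected_component_subset[of ?H f] by blast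
      ultimately show False using assms by auto
    qed
    ultimately have "\<not> (?d z \<le> t \<and> t \<le> ?d f)"
      using connectedD_interval[of "?d ` ?C" "?d z" "?d f" t] by blast
    then have "\<not> ?d z \<le> t" using assms(2) by simp
    then show "z \<in> ?R" by simp
  qed
qed

lemma focal_parameters:
  assumes f: "f\<^sup>2 = D" and "M \<le> 2 * cmod D"
  shows "transverse_length f (- f) (sqrt (2 * cmod D - M)) = sqrt (2 * cmod D + M)"
    and "dist f (- f) = 2 * sqrt (cmod D)"
proof -
  have "cmod f = sqrt (cmod D)"
    using f by (metis norm_ge_zero norm_power real_sqrt_unique)
  moreover have "dist f (- f) = 2 * cmod f"
    by (simp add: dist_norm norm_mult mult_2[symmetric])
  ultimately show "dist f (- f) = 2 * sqrt (cmod D)" by simp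
  then show "transverse_length f (- f) (sqrt (2 * cmod D - M)) = sqrt (2 * cmod D + M)"
    using assms(2) by (simp add: transverse_length_def power_mult_distrib)
qed

lemma hyperbola_eq_conic:
  assumes f: "f\<^sup>2 = D" and M: "\<bar>M\<bar> < 2 * cmod D"
  shows "hyperbola f (- f) (sqrt (2 * cmod D - M)) = {z. focal_form D M z = 4 * (cmod D)\<^sup>2 - M\<^sup>2}"
  using focal_difference_compare(2)[OF f M] focal_parameters(1)[OF f, of M] M
  by (auto simp: hyperbola_def)

text \<open>No bound on \<open>M\<close> is assumed: \<open>sqrt\<close> is odd on the reals, so a
  positive axis length already forces M < 2 |D|, and then the transverse length is known.\<close>

lemma nondegenerate_hyperbola_iff:
  assumes f: "f\<^sup>2 = D"
  shows "nondegenerate_hyperbola f (- f) (sqrt (2 * cmod D - M)) \<longleftrightarrow> \<bar>M\<bar> < 2 * cmod D"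
  using focal_parameters(1)[OF f, of M] by (auto simp: nondegenerate_hyperbola_def)

text \<open>The components of the two foci are the sets where the signed focal difference exceeds
  the transverse length in one or the other sign; the second follows from the first by exchanging
  the foci.\<close>

lemma hyperbolic_disc_eq:
  assumes f: "f\<^sup>2 = D" and M: "\<bar>M\<bar> < 2 * cmod D"
  shows "hyperbolic_disc f (- f) (sqrt (2 * cmod D - M)) = {z. focal_form D M z \<ge> 4 * (cmod D)\<^sup>2 - M\<^sup>2}"
proof -
  let ?t = "sqrt (2 * cmod D + M)"
  have H: "hyperbola f (- f) (sqrt (2 * cmod D - M)) = {z. \<bar>dist z f - dist z (- f)\<bar> = ?t}"
    using focal_parameters(1)[OF f, of M] M by (auto simp: hyperbola_def)
  have H': "{z. \<bar>dist z f - dist z (- f)\<bar> = ?t} = {z. \<bar>dist z (- f) - dist z f\<bar> = ?t}"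
    by (simp add: abs_minus_commute)
  have t: "0 < ?t" using M by simp
  have "?t < sqrt (4 * cmod D)" using M by simp
  also have "\<dots> = dist f (- f)" using focal_parameters(2)[OF f, of M] M by (simp add: real_sqrt_mult)
  finally have td: "?t < dist f (- f)" .
  have 1: "connected_component_set (- {z. \<bar>dist z f - dist z (- f)\<bar> = ?t}) f = {z. dist z (- f) - dist z f > ?t}"
    by (rule connected_component_focal_region[OF t td])
  have 2: "connected_component_set (- {z. \<bar>dist z f - dist z (- f)\<bar> = ?t}) (- f) = {z. dist z f - dist z (- f) > ?t}"
    unfolding H' by (rule connected_component_focal_region) (use t td in \<open>simp_all add: dist_commute\<close>)
  have "hyperbolic_disc f (- f) (sqrt (2 * cmod D - M)) = {z. ?t \<le> \<bar>dist z f - dist z (- f)\<bar>}"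
    unfolding hyperbolic_disc_def H 1 2 by auto
  then show ?thesis using focal_difference_compare(1)[OF f M] by simp
qed

section \<open>The Krein space numerical range\<close>

text \<open>The contribution of the off-diagonal entries of \<open>A\<close> to
  \<open>[A x, x]\<close>; the minus signs come from \<open>J\<close>.\<close>

definition coupling :: "complex \<Rightarrow> complex \<Rightarrow> complex \<Rightarrow> complex \<Rightarrow> complex^5 \<Rightarrow> complex" where
  "coupling b1 b2 b3 b4 x =
     cnj (x$1) * b1 * x$2 + cnj (x$3) * b3 * (x$2 + x$4) + cnj (x$5) * b1 * x$4
     - cnj (x$2) * (b4 * x$1 + b2 * x$3) - cnj (x$4) * (b2 * x$3 + b4 * x$5)"

text \<open>The matrix commutes with the flip of the coordinates; on a flip-invariant vector with
  positive part \<open>p\<close> and negative part a real \<open>n\<close>, the real and imaginary part of the coupling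
  are \<open>n\<close> times the real inner products of \<open>p\<close> with these two vectors.\<close>

definition re_axis :: "complex \<Rightarrow> complex \<Rightarrow> complex \<Rightarrow> complex \<Rightarrow> complex \<times> complex" where
  "re_axis b1 b2 b3 b4 = (b1 - cnj b4, sqrt 2 * (b3 - cnj b2))"

definition im_axis :: "complex \<Rightarrow> complex \<Rightarrow> complex \<Rightarrow> complex \<Rightarrow> complex \<times> complex" where
  "im_axis b1 b2 b3 b4 = (- \<i> * (b1 + cnj b4), - \<i> * sqrt 2 * (b3 + cnj b2))"

abbreviation pos_part :: "complex^5 \<Rightarrow> real" where
  "pos_part x \<equiv> (cmod (x$1))\<^sup>2 + (cmod (x$3))\<^sup>2 + (cmod (x$5))\<^sup>2"
abbreviation neg_part :: "complex^5 \<Rightarrow> real" where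
  "neg_part x \<equiv> (cmod (x$2))\<^sup>2 + (cmod (x$4))\<^sup>2"

section \<open>Support functions of the coupling values, and unions of ellipses\<close>

lemma Cauchy_Schwarz_3:
  fixes a b c x y z :: real
  shows "(a * x + b * y + c * z)\<^sup>2 \<le> (a\<^sup>2 + b\<^sup>2 + c\<^sup>2) * (x\<^sup>2 + y\<^sup>2 + z\<^sup>2)"
proof -
  have "(a\<^sup>2 + b\<^sup>2 + c\<^sup>2) * (x\<^sup>2 + y\<^sup>2 + z\<^sup>2) - (a * x + b * y + c * z)\<^sup>2
    = (a * y - b * x)\<^sup>2 + (a * z - c * x)\<^sup>2 + (b * z - c * y)\<^sup>2"
    by (simp add: power2_eq_square algebra_simps)
  then show ?thesis by (smt (verit) zero_le_power2)
qed

text \<open>The left side is Re (g * coupling) with g = u - i v. It pairs the positive coordinates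
  with a vector depending linearly on the negative ones, so Cauchy-Schwarz applies. The factor sqrt
  2 in the axes reflects the appearance of both negative coordinates next to
  \<open>x$3\<close>.\<close>

lemma coupling_bound:
  "(u * Re (coupling b1 b2 b3 b4 x) + v * Im (coupling b1 b2 b3 b4 x))\<^sup>2
   \<le> (norm (u *\<^sub>R re_axis b1 b2 b3 b4 + v *\<^sub>R im_axis b1 b2 b3 b4))\<^sup>2 * pos_part x * neg_part x"
proof -
  define g where "g = Complex u (- v)"
  define g1 where "g1 = g * b1 - cnj g * cnj b4"
  define g3 where "g3 = g * b3 - cnj g * cnj b2"
  define s where "s = x$2 + x$4"
  have "u * Re (coupling b1 b2 b3 b4 x) + v * Im (coupling b1 b2 b3 b4 x) = Re (g * coupling b1 b2 b3 b4 x)"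
    by (simp add: g_def)
  \<comment> \<open>Summands containing the conjugate of a negative coordinate are replaced by their
    own conjugates, which have the same real part.\<close>
  also have "\<dots> = Re (cnj (x$1) * (g1 * x$2) + cnj (x$3) * (g3 * s) + cnj (x$5) * (g1 * x$4))"
    by (simp add: coupling_def g1_def g3_def s_def algebra_simps)
  finally have eq: "u * Re (coupling b1 b2 b3 b4 x) + v * Im (coupling b1 b2 b3 b4 x) = \<dots>" .
  have "\<bar>u * Re (coupling b1 b2 b3 b4 x) + v * Im (coupling b1 b2 b3 b4 x)\<bar>
    \<le> cmod (cnj (x$1) * (g1 * x$2) + cnj (x$3) * (g3 * s) + cnj (x$5) * (g1 * x$4))"
    unfolding eq by (rule abs_Re_le_cmod)
  also have "\<dots> \<le> cmod (x$1) * (cmod g1 * cmod (x$2)) + cmod (x$3) * (cmod g3 * cmod s) + cmod (x$5) * (cmod g1 * cmod (x$4))"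
    by (intro norm_triangle_le add_mono) (simp_all add: norm_mult)
  finally have "(u * Re (coupling b1 b2 b3 b4 x) + v * Im (coupling b1 b2 b3 b4 x))\<^sup>2
    \<le> (cmod (x$1) * (cmod g1 * cmod (x$2)) + cmod (x$3) * (cmod g3 * cmod s) + cmod (x$5) * (cmod g1 * cmod (x$4)))\<^sup>2"
    by (simp add: abs_le_square_iff[symmetric])
  also have "\<dots> \<le> pos_part x * ((cmod g1 * cmod (x$2))\<^sup>2 + (cmod g3 * cmod s)\<^sup>2 + (cmod g1 * cmod (x$4))\<^sup>2)"
    by (rule Cauchy_Schwarz_3)
  also have "\<dots> \<le> pos_part x * (((cmod g1)\<^sup>2 + 2 * (cmod g3)\<^sup>2) * neg_part x)"
  proof (rule mult_left_mono)
    \<comment> \<open>The loss in this estimate vanishes exactly for x2 = x4, as for flip-invariant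
      vectors.\<close>
    have "(cmod s)\<^sup>2 + (cmod (x$2 - x$4))\<^sup>2 = 2 * neg_part x"
      by (simp only: cmod_power2) (simp add: s_def power2_eq_square algebra_simps)
    then have "(cmod s)\<^sup>2 \<le> 2 * neg_part x" by (smt (verit) zero_le_power2)
    then have "(cmod g3)\<^sup>2 * (cmod s)\<^sup>2 \<le> (cmod g3)\<^sup>2 * (2 * neg_part x)"
      by (rule mult_left_mono) simp
    then show "(cmod g1 * cmod (x$2))\<^sup>2 + (cmod g3 * cmod s)\<^sup>2 + (cmod g1 * cmod (x$4))\<^sup>2
      \<le> ((cmod g1)\<^sup>2 + 2 * (cmod g3)\<^sup>2) * neg_part x"
      by (simp add: power_mult_distrib algebra_simps)
  qed simp
  also have "(cmod g1)\<^sup>2 + 2 * (cmod g3)\<^sup>2 = (norm (u *\<^sub>R re_axis b1 b2 b3 b4 + v *\<^sub>R im_axis b1 b2 b3 b4))\<^sup>2"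
  proof -
    have g: "g = of_real u - \<i> * of_real v" "cnj g = of_real u + \<i> * of_real v"
      by (auto simp: g_def complex_eq_iff)
    have "u *\<^sub>R re_axis b1 b2 b3 b4 + v *\<^sub>R im_axis b1 b2 b3 b4 = (g1, sqrt 2 * g3)"
      unfolding g1_def g3_def g
      by (simp add: re_axis_def im_axis_def scaleR_conv_of_real algebra_simps)
    then show ?thesis
      by (simp add: norm_Pair norm_mult power_mult_distrib)
  qed
  finally show ?thesis by (simp add: mult_ac)
qed

text \<open>The hypothesis \<open>supp\<close> places (\<xi>, \<eta>) in the ellipse with squared
  semi-axes d h and m h. The ellipse shifted by a c along the first axis lies in the hyperbolic
  region because a^2 = d + e. For d = 0 it collapses to a segment, treated separately.\<close>

lemma hyperbola_region_of_support:
  fixes a c d e h m \<xi> \<eta> :: real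
  assumes "0 \<le> d" "0 < m" "0 < e" and a: "a\<^sup>2 = d + e" and c: "c\<^sup>2 = 1 + h"
    and supp: "\<And>u v. (u * \<xi> + v * \<eta>)\<^sup>2 \<le> (d * u\<^sup>2 + m * v\<^sup>2) * h"
  shows "m * e \<le> m * (a * c + \<xi>)\<^sup>2 - e * \<eta>\<^sup>2"
proof (cases "d = 0")
  case True
  then have "\<xi>\<^sup>2 \<le> 0" using supp[of 1 0] by simp
  then have "\<xi> = 0" by simp
  have "e * \<eta>\<^sup>2 \<le> e * (m * h)" using supp[of 0 1] \<open>0 < e\<close> by (simp add: \<open>\<xi> = 0\<close>)
  moreover have "(a * c)\<^sup>2 = e * (1 + h)" using a c True by (simp add: power_mult_distrib)
  ultimately show ?thesis by (simp add: \<open>\<xi> = 0\<close> algebra_simps)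
next
  case False
  then have d: "0 < d" using \<open>0 \<le> d\<close> by simp
  define S X where "S = m * \<xi>\<^sup>2 + d * \<eta>\<^sup>2" and "X = a * c + \<xi>"
  \<comment> \<open>The support inequality is used in the direction normal to the level curve of
    \<open>S\<close> through (\<xi>, \<eta>).\<close>
  have "S\<^sup>2 \<le> (d * m * h) * S"
    using supp[of "m * \<xi>" "d * \<eta>"] by (simp add: S_def power2_eq_square algebra_simps)
  moreover have "0 \<le> m * h" using order_trans[OF zero_le_power2 supp[of 0 1]] by simp
  then have "0 \<le> h" using \<open>0 < m\<close> by (simp add: zero_le_mult_iff)
  moreover have "0 \<le> S" using d \<open>0 < m\<close> by (simp add: S_def)
  ultimately have S: "S \<le> d * m * h"
    using d \<open>0 < m\<close> by (cases "S = 0") (simp_all add: power2_eq_square)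
  \<comment> \<open>Completing the square. Equality means e \<xi> = - d X, which is where the
    ellipse touches the hyperbola family and which dictates the witnesses of
    \<open>hyperbola_region_attained\<close>.\<close>
  have "a\<^sup>2 * (d * X\<^sup>2 + e * \<xi>\<^sup>2 - d * e * c\<^sup>2) = a\<^sup>2 * (d * X\<^sup>2 + e * \<xi>\<^sup>2) - d * e * (X - \<xi>)\<^sup>2"
    by (simp add: X_def power2_eq_square algebra_simps)
  also have "\<dots> = (d * X + e * \<xi>)\<^sup>2"
    unfolding a by (simp add: power2_eq_square algebra_simps)
  finally have "0 \<le> a\<^sup>2 * (d * X\<^sup>2 + e * \<xi>\<^sup>2 - d * e * c\<^sup>2)" by simp
  then have "d * e * c\<^sup>2 \<le> d * X\<^sup>2 + e * \<xi>\<^sup>2"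
    using a d \<open>0 < e\<close> by (simp add: zero_le_mult_iff)
  then have "m * (d * e * (1 + h)) \<le> m * (d * X\<^sup>2 + e * \<xi>\<^sup>2)"
    unfolding c using \<open>0 < m\<close> by simp
  moreover have "e * S \<le> e * (d * m * h)" using S \<open>0 < e\<close> by simp
  ultimately have "d * (m * e) \<le> d * (m * X\<^sup>2 - e * \<eta>\<^sup>2)"
    by (simp add: S_def algebra_simps)
  then show ?thesis using d by (simp add: X_def)
qed

text \<open>In dimension above two some \<open>e\<close> is orthogonal to \<open>f\<close> and
  \<open>g\<close>. Adding multiples of it keeps both inner products, while the norm grows
  continuously past any bound.\<close>

lemma norm_attained_off_plane:
  fixes f g :: "'a::euclidean_space"
  assumes "DIM('a) > 2" and "(norm p)\<^sup>2 \<le> r"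
  obtains q where "(norm q)\<^sup>2 = r" "f \<bullet> q = f \<bullet> p" "g \<bullet> q = g \<bullet> p"
proof -
  have "dim {f, g} < DIM('a)"
    using dim_le_card'[of "{f, g}"] card_insert_le_m1[of 2 "{g}" f] assms(1) by simp
  then obtain e where e: "e \<noteq> 0" "\<And>y. y \<in> span {f, g} \<Longrightarrow> orthogonal e y"
    using orthogonal_to_subspace_exists by blast
  have "orthogonal e f" "orthogonal e g"
    by (rule e(2), rule span_base, simp)+
  then have fe: "f \<bullet> e = 0" "g \<bullet> e = 0"
    by (simp_all add: orthogonal_def inner_commute)
  let ?\<phi> = "\<lambda>t. (norm (p + t *\<^sub>R e))\<^sup>2"
  \<comment> \<open>Chosen so that the triangle inequality gives norm at least \<open>sqrt r\<close>
    at this parameter.\<close>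
  let ?b = "(norm p + sqrt r) / norm e"
  have r: "0 \<le> r" using assms(2) zero_le_power2 order_trans by blast
  have "norm (?b *\<^sub>R e) = norm p + sqrt r" using e r by simp
  then have "sqrt r \<le> norm (p + ?b *\<^sub>R e)" using norm_triangle_ineq4[of "p + ?b *\<^sub>R e" p] by simp
  then have "r \<le> ?\<phi> ?b" using r by (metis real_sqrt_ge_zero real_sqrt_pow2 power_mono)
  moreover have "?\<phi> 0 \<le> r" using assms(2) by simp
  moreover have "0 \<le> ?b" using r by simp
  ultimately obtain t where "?\<phi> t = r"
    using IVT'[of ?\<phi> 0 r ?b] by (force intro!: continuous_intros)
  then show thesis
    by (intro that[of "p + t *\<^sub>R e"]) (simp_all add: inner_add_right fe)
qed

text \<open>The point to be attained lies on the ellipse of the vectors with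
  \<open>c = \<bar>a X\<bar> / e\<close> as value of \<open>(norm p)\<^sup>2 + n\<^sup>2\<close>; this choice needs no division by \<open>d\<close>, which may be \<open>0\<close>.\<close>

lemma hyperbola_region_attained:
  fixes f g :: "'a::euclidean_space" and a d e m X Y :: real
  assumes dim: "DIM('a) > 2" and fg: "f \<bullet> g = 0" and d: "(norm f)\<^sup>2 = 4 * d" and m: "(norm g)\<^sup>2 = 4 * m"
    and "0 < m" "0 < e" and a: "a\<^sup>2 = d + e"
    and region: "m * e \<le> m * X\<^sup>2 - e * Y\<^sup>2"
  obtains \<epsilon> n :: real and p :: 'a where "\<epsilon> = 1 \<or> \<epsilon> = - 1" "(norm p)\<^sup>2 - n\<^sup>2 = \<epsilon>"
    "a * ((norm p)\<^sup>2 + n\<^sup>2) + n * (f \<bullet> p) = \<epsilon> * X" "n * (g \<bullet> p) = \<epsilon> * Y"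
proof -
  have d0: "0 \<le> d" using d zero_le_power2[of "norm f"] by linarith
  have a0: "a \<noteq> 0" using a d0 \<open>0 < e\<close> by auto
  have Y: "Y\<^sup>2 / m + 1 \<le> X\<^sup>2 / e"
  proof -
    have "0 \<le> (m * X\<^sup>2 - e * Y\<^sup>2 - m * e) / (m * e)"
      using region \<open>0 < m\<close> \<open>0 < e\<close> by simp
    also have "\<dots> = X\<^sup>2 / e - Y\<^sup>2 / m - 1"
      using \<open>0 < m\<close> \<open>0 < e\<close> by (simp add: diff_divide_distrib)
    finally show ?thesis by simp
  qed
  have X2: "1 \<le> X\<^sup>2 / e" using Y \<open>0 < m\<close> by (smt (verit) divide_nonneg_pos zero_le_power2)
  then have X0: "X \<noteq> 0" using \<open>0 < e\<close> by auto
  \<comment> \<open>The sign of a X decides whether a vector of positive or of negative square is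
    used; it makes \<open>c\<close> nonnegative.\<close>
  define \<epsilon> where "\<epsilon> = sgn (a * X)"
  have eps: "\<epsilon> = 1 \<or> \<epsilon> = - 1" using a0 X0 by (auto simp: \<epsilon>_def sgn_if)
  then have eps2: "\<epsilon> * \<epsilon> = 1" by auto
  define c where "c = \<epsilon> * a * X / e"
  have cpos: "c \<ge> 0" using \<open>0 < e\<close> eps
    by (auto simp: c_def \<epsilon>_def sgn_if split: if_splits)
  have c2: "c\<^sup>2 = X\<^sup>2 / e + d * X\<^sup>2 / e\<^sup>2"
  proof -
    have "c\<^sup>2 = (\<epsilon> * \<epsilon>) * a\<^sup>2 * X\<^sup>2 / e\<^sup>2" by (simp add: c_def power2_eq_square)
    also have "\<dots> = X\<^sup>2 / e + d * X\<^sup>2 / e\<^sup>2"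
      unfolding eps2 a using \<open>0 < e\<close> by (simp add: power2_eq_square distrib_right add_divide_distrib)
    finally show ?thesis .
  qed
  \<comment> \<open>For the vector sought, the sum \<open>c\<close> and the difference
    \<open>\<epsilon>\<close> of |p|^2 and n^2 give c^2 - 1 = 4 n^2 |p|^2. This inequality thus says
    that \<open>p0\<close> below is short enough.\<close>
  have gap: "d * X\<^sup>2 / e\<^sup>2 + Y\<^sup>2 / m \<le> c\<^sup>2 - 1" using Y c2 by simp
  have "0 \<le> d * X\<^sup>2 / e\<^sup>2" using d0 by simp
  then have "1\<^sup>2 \<le> c\<^sup>2" using X2 c2 by simp
  then have c1: "1 \<le> c" using cpos by (rule power2_le_imp_le)
  define n where "n = sqrt ((c - \<epsilon>) / 2)"
  have n2: "n\<^sup>2 = (c - \<epsilon>) / 2" using c1 eps by (auto simp: n_def)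
  have ac: "a * c = \<epsilon> * (X + d * X / e)"
  proof -
    have "a * c = \<epsilon> * a\<^sup>2 * X / e" by (simp add: c_def power2_eq_square)
    also have "\<dots> = \<epsilon> * (X + d * X / e)"
      unfolding a using \<open>0 < e\<close> by (simp add: distrib_left distrib_right add_divide_distrib)
    finally show ?thesis .
  qed
  \<comment> \<open>The combination of \<open>f\<close> and \<open>g\<close> with n (f . p0) = -
    \<epsilon> d X / e and n (g . p0) = \<epsilon> Y when \<open>n\<close> is nonzero. As f . f = 4
    d, the factor \<open>d\<close> arises by itself and is never divided by.\<close>
  define p0 where "p0 = (if n = 0 then 0 else (- (\<epsilon> * X / (4 * n * e))) *\<^sub>R f + (\<epsilon> * Y / (4 * n * m)) *\<^sub>R g)"
  have gf: "g \<bullet> f = 0" using fg by (simp add: inner_commute)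
  have ff: "f \<bullet> f = 4 * d" "g \<bullet> g = 4 * m" using d m by (simp_all add: power2_norm_eq_inner)
  have "(norm p0)\<^sup>2 \<le> (c + \<epsilon>) / 2"
  proof (cases "n = 0")
    case True
    then show ?thesis using c1 eps by (auto simp: p0_def)
  next
    case False
    have comb: "(norm (s *\<^sub>R f + t *\<^sub>R g))\<^sup>2 = s\<^sup>2 * (4 * d) + t\<^sup>2 * (4 * m)" for s t
      unfolding power2_norm_eq_inner inner_add_left inner_add_right inner_scaleR_left inner_scaleR_right ff fg gf
      by (simp add: power2_eq_square)
    have "(- (\<epsilon> * X / (4 * n * e)))\<^sup>2 * (4 * d) = (\<epsilon> * \<epsilon>) * (d * X\<^sup>2 / e\<^sup>2) / (4 * n\<^sup>2)"
      and "(\<epsilon> * Y / (4 * n * m))\<^sup>2 * (4 * m) = (\<epsilon> * \<epsilon>) * (Y\<^sup>2 / m) / (4 * n\<^sup>2)"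
      using \<open>0 < m\<close> by (simp_all add: power2_eq_square mult_ac)
    then have "(norm p0)\<^sup>2 = (\<epsilon> * \<epsilon>) * (d * X\<^sup>2 / e\<^sup>2 + Y\<^sup>2 / m) / (4 * n\<^sup>2)"
      unfolding p0_def if_not_P[OF False] comb by (simp only: distrib_left add_divide_distrib)
    also have "\<dots> = (d * X\<^sup>2 / e\<^sup>2 + Y\<^sup>2 / m) / (4 * n\<^sup>2)" by (simp add: eps2)
    also have "\<dots> \<le> (c\<^sup>2 - 1) / (4 * n\<^sup>2)" using gap by (simp add: divide_right_mono)
    also have "c\<^sup>2 - 1 = 2 * n\<^sup>2 * (c + \<epsilon>)"
      unfolding n2 using eps2 by (simp add: power2_eq_square algebra_simps)
    also have "2 * n\<^sup>2 * (c + \<epsilon>) / (4 * n\<^sup>2) = (c + \<epsilon>) / 2"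
      using False by simp
    finally show ?thesis .
  qed
  then obtain p where p: "(norm p)\<^sup>2 = (c + \<epsilon>) / 2" "f \<bullet> p = f \<bullet> p0" "g \<bullet> p = g \<bullet> p0"
    by (rule norm_attained_off_plane[OF dim])
  have "n * (f \<bullet> p) = - (\<epsilon> * d * X / e)" and "n * (g \<bullet> p) = \<epsilon> * Y"
  proof -
    \<comment> \<open>For n = 0 the products cannot be prescribed, but then c = 1 and
      \<open>gap\<close> makes both required values zero.\<close>
    have "d * X / e = 0 \<and> Y = 0" if "n = 0"
    proof -
      have "c = 1" using that n2 eps c1 by auto
      then have "d * X\<^sup>2 / e\<^sup>2 + Y\<^sup>2 / m \<le> 0" using gap by simp
      moreover have "0 \<le> d * X\<^sup>2 / e\<^sup>2" "0 \<le> Y\<^sup>2 / m" using d0 \<open>0 < m\<close> by simp_all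
      ultimately have "d * X\<^sup>2 / e\<^sup>2 = 0" "Y\<^sup>2 / m = 0" by linarith+
      then show ?thesis using \<open>0 < m\<close> by auto
    qed
    then show "n * (f \<bullet> p) = - (\<epsilon> * d * X / e)" and "n * (g \<bullet> p) = \<epsilon> * Y"
      using \<open>0 < m\<close> \<open>0 < e\<close> p by (auto simp: p0_def inner_add_right inner_diff_right ff fg gf)
  qed
  moreover have "2 * (norm p)\<^sup>2 = c + \<epsilon>" "2 * n\<^sup>2 = c - \<epsilon>" by (simp_all add: p(1) n2)
  then have "(norm p)\<^sup>2 + n\<^sup>2 = c" "(norm p)\<^sup>2 - n\<^sup>2 = \<epsilon>" by simp_all
  ultimately show thesis
    using ac eps by (intro that[of \<epsilon> p n]) (simp_all add: algebra_simps)
qed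

section \<open>The range of the concrete matrix\<close>

definition signature5 :: "complex^5^5" where
  "signature5 = diagonal_matrix (vector [1, -1, 1, -1, 1])"

definition tridiagonal5 :: "real \<Rightarrow> complex \<Rightarrow> complex \<Rightarrow> complex \<Rightarrow> complex \<Rightarrow> complex^5^5" where
  "tridiagonal5 a b1 b2 b3 b4 = vector
      [vector [complex_of_real a, b1, 0, 0, 0],
       vector [b4, - complex_of_real a, b2, 0, 0],
       vector [0, b3, complex_of_real a, b3, 0],
       vector [0, 0, b2, - complex_of_real a, b4],
       vector [0, 0, 0, b1, complex_of_real a]]"

lemma krein_form_signature5:
  "krein_form signature5 x y = cnj (y$1) * x$1 - cnj (y$2) * x$2 + cnj (y$3) * x$3 - cnj (y$4) * x$4 + cnj (y$5) * x$5"
  by (simp add: krein_form_def signature5_def diagonal_matrix_def matrix_vector_mult_def sum_5 vector_5)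

lemma of_real_cmod_square: "(complex_of_real (cmod z))\<^sup>2 = z * cnj z"
  by (metis complex_norm_square of_real_power)

lemma krein_form_self_signature5: "krein_form signature5 x x = of_real (pos_part x - neg_part x)"
  unfolding krein_form_signature5 by (simp add: of_real_cmod_square mult.commute)

lemma krein_form_tridiagonal5:
  "krein_form signature5 (tridiagonal5 a b1 b2 b3 b4 *v x) x
   = of_real (a * (pos_part x + neg_part x)) + coupling b1 b2 b3 b4 x"
proof -
  have mv: "(tridiagonal5 a b1 b2 b3 b4 *v x) $ 1 = of_real a * x$1 + b1 * x$2"
    "(tridiagonal5 a b1 b2 b3 b4 *v x) $ 2 = b4 * x$1 - of_real a * x$2 + b2 * x$3"
    "(tridiagonal5 a b1 b2 b3 b4 *v x) $ 3 = b3 * x$2 + of_real a * x$3 + b3 * x$4"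
    "(tridiagonal5 a b1 b2 b3 b4 *v x) $ 4 = b2 * x$3 - of_real a * x$4 + b4 * x$5"
    "(tridiagonal5 a b1 b2 b3 b4 *v x) $ 5 = b1 * x$4 + of_real a * x$5"
    by (simp_all add: tridiagonal5_def matrix_vector_mult_def sum_5 vector_5)
  show ?thesis
    unfolding krein_form_signature5 mv coupling_def
    by (simp add: of_real_cmod_square algebra_simps)
qed

text \<open>The factor \<epsilon> absorbs the minus sign in front of the negative half, so that both
  halves of the range are handled at once.\<close>

lemma krein_range_tridiagonal5:
  "z \<in> krein_range signature5 (tridiagonal5 a b1 b2 b3 b4) \<longleftrightarrow>
   (\<exists>\<epsilon> x. (\<epsilon> = 1 \<or> \<epsilon> = - 1) \<and> pos_part x - neg_part x = \<epsilon> \<and>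
      of_real \<epsilon> * z = of_real (a * (pos_part x + neg_part x)) + coupling b1 b2 b3 b4 x)"
proof -
  have 1: "krein_form signature5 x x = 1 \<longleftrightarrow> pos_part x - neg_part x = 1" for x
    unfolding krein_form_self_signature5 by (rule of_real_eq_1_iff)
  have 2: "krein_form signature5 x x = - 1 \<longleftrightarrow> pos_part x - neg_part x = - 1" for x
    using of_real_eq_iff[of "pos_part x - neg_part x" "- 1", where 'a = complex]
    unfolding krein_form_self_signature5 by simp
  let ?v = "\<lambda>x. of_real (a * (pos_part x + neg_part x)) + coupling b1 b2 b3 b4 x"
  have "z \<in> krein_range signature5 (tridiagonal5 a b1 b2 b3 b4) \<longleftrightarrow>
    (\<exists>x. pos_part x - neg_part x = 1 \<and> z = ?v x) \<or> (\<exists>x. pos_part x - neg_part x = - 1 \<and> z = - ?v x)"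
    unfolding krein_range_def krein_range_pos_def krein_range_neg_def krein_form_tridiagonal5 1 2 by blast
  also have "\<dots> \<longleftrightarrow> (\<exists>x. pos_part x - neg_part x = 1 \<and> of_real 1 * z = ?v x) \<or>
    (\<exists>x. pos_part x - neg_part x = - 1 \<and> of_real (- 1) * z = ?v x)"
    unfolding of_real_1 of_real_minus mult_minus_left mult_1_left minus_equation_iff[of z] by (metis (no_types))
  finally show ?thesis by blast
qed

text \<open>The Gram matrix of the axes: |u f + v g|^2 = 4 (a^2 u^2 - Q(u, v)), where Q is the
  quadratic form \<open>Q\<^sub>2\<close> from the opening of the proof.\<close>

lemma axes_inner:
  fixes a :: real and b1 b2 b3 b4 D :: complex and M :: real
  assumes D: "D = (complex_of_real a)\<^sup>2 + b1 * b4 + 2 * b2 * b3"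
    and M: "M = 2 * a\<^sup>2 - (cmod b1)\<^sup>2 - (cmod b4)\<^sup>2 - 2 * (cmod b2)\<^sup>2 - 2 * (cmod b3)\<^sup>2"
  defines "f \<equiv> re_axis b1 b2 b3 b4" and "g \<equiv> im_axis b1 b2 b3 b4"
  shows "4 * a\<^sup>2 - f \<bullet> f = M + 2 * Re D" "g \<bullet> g = 2 * Re D - M" "f \<bullet> g = - 2 * Im D"
proof -
  have rr: "sqrt 2 * (sqrt 2 * t) = 2 * t" for t :: real
    by (simp flip: mult.assoc)
  show "4 * a\<^sup>2 - f \<bullet> f = M + 2 * Re D" "g \<bullet> g = 2 * Re D - M" "f \<bullet> g = - 2 * Im D"
    unfolding f_def g_def re_axis_def im_axis_def D M cmod_power2
    by (simp_all add: inner_complex_def power2_eq_square rr algebra_simps)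
qed

lemma krein_range_eq_focal_region:
  fixes a :: real and b1 b2 b3 b4 D :: complex and M :: real
  assumes D: "D = (complex_of_real a)\<^sup>2 + b1 * b4 + 2 * b2 * b3"
    and M: "M = 2 * a\<^sup>2 - (cmod b1)\<^sup>2 - (cmod b4)\<^sup>2 - 2 * (cmod b2)\<^sup>2 - 2 * (cmod b3)\<^sup>2"
    and MD: "\<bar>M\<bar> < 2 * cmod D"
  shows "krein_range signature5 (tridiagonal5 a b1 b2 b3 b4) = {z. 4 * (cmod D)\<^sup>2 - M\<^sup>2 \<le> focal_form D M z}"
proof -
  define f where "f = re_axis b1 b2 b3 b4"
  define g where "g = im_axis b1 b2 b3 b4"
  have fg: "f \<bullet> f = 4 * a\<^sup>2 - M - 2 * Re D" "g \<bullet> g = 2 * Re D - M" "f \<bullet> g = - 2 * Im D"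
    using axes_inner[OF D M] by (simp_all add: f_def g_def)
  have disc: "4 * (cmod D)\<^sup>2 - M\<^sup>2 = (2 * Re D - M) * (M + 2 * Re D) + 4 * (Im D)\<^sup>2"
    by (simp only: cmod_power2) (simp add: power2_eq_square algebra_simps)
  have "M\<^sup>2 < (2 * cmod D)\<^sup>2"
    using power_strict_mono[OF MD, of 2] by simp
  then have disc_pos: "0 < 4 * (cmod D)\<^sup>2 - M\<^sup>2" by (simp add: power_mult_distrib)
  have "g \<noteq> 0"
  proof
    assume "g = 0"
    then have "2 * Re D - M = 0" "Im D = 0" using fg by auto
    then show False using disc disc_pos by simp
  qed
  \<comment> \<open>\<open>m\<close> is a quarter of |g|^2 and \<open>k\<close> the Gram-Schmidt
    coefficient (f . g) / (g . g). The value of \<open>e\<close> is chosen so that \<open>d\<close>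
    becomes a quarter of |f - k g|^2, as \<open>f'f'\<close> confirms.\<close>
  define m where "m = (2 * Re D - M) / 4"
  define k where "k = - Im D / (2 * m)"
  define e where "e = (4 * (cmod D)\<^sup>2 - M\<^sup>2) / (16 * m)"
  define d where "d = a\<^sup>2 - e"
  have "0 < g \<bullet> g" using \<open>g \<noteq> 0\<close> by simp
  then have m: "0 < m" using fg by (simp add: m_def)
  have e: "0 < e" using m disc_pos by (simp add: e_def)
  have a: "a\<^sup>2 = d + e" by (simp add: d_def)
  text \<open>The shear \<open>X = Re z - k * Im z\<close> fixes the real axis and makes the two axes orthogonal.\<close>
  define f' where "f' = f - k *\<^sub>R g"
  have gg: "g \<bullet> g = 4 * m" using fg by (simp add: m_def)
  have km: "k * m = - Im D / 2" using m by (simp add: k_def)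
  have fgk: "f \<bullet> g = 4 * (k * m)" unfolding km using fg(3) by simp
  have em: "4 * (cmod D)\<^sup>2 - M\<^sup>2 = 16 * (m * e)" using m by (simp add: e_def)
  have f'g: "f' \<bullet> g = 0" using fg(3) gg km by (simp add: f'_def inner_diff_left)
  have m4: "2 * Re D - M = 4 * m" by (simp add: m_def)
  have "4 * m * (M + 2 * Re D + 4 * k * k * m) = (4 * m) * (M + 2 * Re D) + 16 * (k * m)\<^sup>2"
    by (simp add: power2_eq_square algebra_simps)
  also have "\<dots> = 4 * m * (4 * e)"
    using em disc unfolding km m4 by (simp add: power2_eq_square)
  finally have S: "M + 2 * Re D = 4 * e - 4 * k * k * m"
    using m by simp
  have f'f': "f' \<bullet> f' = 4 * d"
  proof -
    have "f' \<bullet> f' = f' \<bullet> f" using f'g by (subst (2) f'_def) (simp add: inner_diff_right)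
    also have "\<dots> = f \<bullet> f - k * (f \<bullet> g)" by (simp add: f'_def inner_diff_left inner_commute[of g f])
    also have "\<dots> = 4 * a\<^sup>2 - (M + 2 * Re D + 4 * k * k * m)"
      unfolding fgk using fg(1) by (simp add: algebra_simps)
    finally show ?thesis unfolding S by (simp add: d_def)
  qed
  have "0 \<le> f' \<bullet> f'" by simp
  then have d: "0 \<le> d" using f'f' by simp
  have form: "focal_form D M z = 16 * (m * (Re z - k * Im z)\<^sup>2 - e * (Im z)\<^sup>2)" for z
  proof -
    have "focal_form D M z = 4 * (2 * Re D - M) * (Re z)\<^sup>2 + 16 * Im D * Re z * Im z - 4 * (M + 2 * Re D) * (Im z)\<^sup>2"
      unfolding focal_form_def cmod_power2 by (simp add: power2_eq_square algebra_simps)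
    also have "Im D = - 2 * (k * m)" using km by simp
    finally show ?thesis unfolding S m4 by (simp add: power2_eq_square algebra_simps)
  qed
  have region: "4 * (cmod D)\<^sup>2 - M\<^sup>2 \<le> focal_form D M z \<longleftrightarrow> m * e \<le> m * (Re z - k * Im z)\<^sup>2 - e * (Im z)\<^sup>2" for z
    unfolding form em by (rule mult_le_cancel_left_pos) simp
  show ?thesis
  proof (intro set_eqI iffI; unfold mem_Collect_eq region)
    fix z assume "z \<in> krein_range signature5 (tridiagonal5 a b1 b2 b3 b4)"
    then obtain \<epsilon> x where eps: "\<epsilon> = 1 \<or> \<epsilon> = - 1" and x: "pos_part x - neg_part x = \<epsilon>"
      and z: "of_real \<epsilon> * z = of_real (a * (pos_part x + neg_part x)) + coupling b1 b2 b3 b4 x"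
      unfolding krein_range_tridiagonal5 by blast
    define \<zeta> where "\<zeta> = coupling b1 b2 b3 b4 x"
    define c h where "c = pos_part x + neg_part x" and "h = 4 * pos_part x * neg_part x"
    have "c\<^sup>2 = (pos_part x - neg_part x)\<^sup>2 + h"
      by (simp add: c_def h_def power2_eq_square algebra_simps)
    then have c: "c\<^sup>2 = 1 + h" unfolding x using eps by auto
    have "(u * (Re \<zeta> - k * Im \<zeta>) + v * Im \<zeta>)\<^sup>2 \<le> (d * u\<^sup>2 + m * v\<^sup>2) * h" for u v
    proof -
      \<comment> \<open>Testing the sheared point in direction (u, v) means testing the original one
        in direction (u, v - k u).\<close>
      have "(u * Re \<zeta> + (v - k * u) * Im \<zeta>)\<^sup>2 \<le> (norm (u *\<^sub>R f + (v - k * u) *\<^sub>R g))\<^sup>2 * pos_part x * neg_part x"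
        unfolding \<zeta>_def f_def g_def by (rule coupling_bound)
      moreover have "u *\<^sub>R f + (v - k * u) *\<^sub>R g = u *\<^sub>R f' + v *\<^sub>R g"
        by (simp add: f'_def algebra_simps)
      moreover have "(norm (u *\<^sub>R f' + v *\<^sub>R g))\<^sup>2 = 4 * (d * u\<^sup>2 + m * v\<^sup>2)"
        using f'g f'f' gg
        by (simp add: power2_norm_eq_inner inner_add_left inner_add_right inner_commute[of g f'])
           (simp add: power2_eq_square)
      ultimately show ?thesis by (simp add: h_def algebra_simps)
    qed
    from hyperbola_region_of_support[OF d m e a c this]
    have supp: "m * e \<le> m * (a * c + (Re \<zeta> - k * Im \<zeta>))\<^sup>2 - e * (Im \<zeta>)\<^sup>2" .
    have "a * c + Re \<zeta> = \<epsilon> * Re z" "Im \<zeta> = \<epsilon> * Im z"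
      using arg_cong[OF z, of Re] arg_cong[OF z, of Im] by (simp_all add: c_def \<zeta>_def)
    then have X: "a * c + (Re \<zeta> - k * Im \<zeta>) = \<epsilon> * (Re z - k * Im z)" and Y: "Im \<zeta> = \<epsilon> * Im z"
      by (simp_all add: algebra_simps)
    have "\<epsilon>\<^sup>2 = 1" using eps by auto
    then show "m * e \<le> m * (Re z - k * Im z)\<^sup>2 - e * (Im z)\<^sup>2"
      using supp unfolding X unfolding Y by (simp add: power_mult_distrib)
  next
    fix z assume "m * e \<le> m * (Re z - k * Im z)\<^sup>2 - e * (Im z)\<^sup>2"
    moreover have "DIM(complex \<times> complex) > 2" by simp
    ultimately obtain \<epsilon> n p where eps: "\<epsilon> = 1 \<or> \<epsilon> = - 1" and p: "(norm p)\<^sup>2 - n\<^sup>2 = \<epsilon>"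
      "a * ((norm p)\<^sup>2 + n\<^sup>2) + n * (f' \<bullet> p) = \<epsilon> * (Re z - k * Im z)" "n * (g \<bullet> p) = \<epsilon> * Im z"
      using hyperbola_region_attained[of f' g d m e a "Re z - k * Im z" "Im z"] f'g f'f' gg m e a
      by (metis power2_norm_eq_inner)
    obtain p1 p3 where p13: "p = (p1, p3)" by (cases p)
    define r where "r = complex_of_real (sqrt 2)"
    have rr: "r * r = 2" "r * (r * t) = 2 * t" for t
      by (simp_all add: r_def mult.assoc[symmetric] flip: of_real_mult)
    have "cmod r = sqrt 2" by (simp add: r_def)
    then have half: "(cmod (r / 2 * t))\<^sup>2 = (cmod t)\<^sup>2 / 2" for t
      by (simp add: norm_mult norm_divide power_mult_distrib power_divide)
    \<comment> \<open>The flip-invariant vector: p1 and n are each split into two equal coordinates,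
      and r / 2 = 1 / sqrt 2 preserves the norms.\<close>
    define x :: "complex^5" where
      "x = vector [r / 2 * p1, r / 2 * of_real n, p3, r / 2 * of_real n, r / 2 * p1]"
    have pos: "pos_part x = (norm p)\<^sup>2" and neg: "neg_part x = n\<^sup>2"
      unfolding x_def vector_5 half by (simp_all add: p13 norm_Pair)
    have cpl: "coupling b1 b2 b3 b4 x = of_real n * (cnj p1 * b1 + r * cnj p3 * b3 - b4 * p1 - r * b2 * p3)"
    proof -
      have "cnj r = r" by (simp add: r_def)
      then show ?thesis
        unfolding coupling_def x_def vector_5 by (simp add: algebra_simps rr)
    qed
    have Re: "Re (coupling b1 b2 b3 b4 x) = n * (f \<bullet> p)"
      unfolding cpl r_def by (simp add: f_def re_axis_def p13 inner_complex_def algebra_simps)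
    have Im: "Im (coupling b1 b2 b3 b4 x) = n * (g \<bullet> p)"
      unfolding cpl r_def by (simp add: g_def im_axis_def p13 inner_complex_def algebra_simps)
    have "f \<bullet> p = f' \<bullet> p + k * (g \<bullet> p)" by (simp add: f'_def inner_diff_left)
    then have "n * (f \<bullet> p) = n * (f' \<bullet> p) + k * (\<epsilon> * Im z)"
      using p(3) by (simp add: algebra_simps)
    then have "of_real \<epsilon> * z = of_real (a * (pos_part x + neg_part x)) + coupling b1 b2 b3 b4 x"
      unfolding pos neg using p Re Im by (simp add: complex_eq_iff algebra_simps)
    moreover have "pos_part x - neg_part x = \<epsilon>" unfolding pos neg by (rule p(1))
    ultimately show "z \<in> krein_range signature5 (tridiagonal5 a b1 b2 b3 b4)"
      unfolding krein_range_tridiagonal5 using eps by blast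
  qed
qed

section \<open>Dual curves of linear and quadratic factors\<close>

definition curve_of :: "poly3 \<Rightarrow> complex set" where
  "curve_of P = \<Union> {dual_real_part q | q. irreducible q \<and> q dvd P}"

text \<open>By unique factorisation irreducible polynomials are prime, so a component of the product
  is a component of a factor.\<close>

lemma curve_of_mult: "curve_of (P * Q) = curve_of P \<union> curve_of Q"
proof -
  have "q dvd P * Q \<longleftrightarrow> q dvd P \<or> q dvd Q" if "irreducible q" for q
    using irreducible_imp_prime_elem[OF that] by (rule prime_elem_dvd_mult_iff)
  then show ?thesis unfolding curve_of_def by blast
qed

lemma const3_1: "const3 1 = 1"
  by (simp add: const3_def one_pCons)

lemma const3_mult: "const3 a * const3 b = const3 (a * b)"
  by (simp add: const3_def)

lemma irreducible_dvd_irreducible_poly3: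
  fixes F q :: poly3
  assumes "irreducible F" "irreducible q" "q dvd F"
  obtains k where "k \<noteq> 0" "q = const3 k * F"
proof -
  from assms(3) obtain t where t: "F = q * t" by (elim dvdE)
  then have "t dvd 1" using assms(1,2) irreducibleD irreducible_not_unit by blast
  then obtain k where k: "k \<noteq> 0" "t = const3 k"
    by (auto simp: is_unit_poly_iff const3_def dvd_field_iff)
  then have "q = const3 (1 / k) * F" using k by (simp add: t mult.left_commute const3_mult const3_1)
  then show thesis using k by (intro that[of "1 / k"]) simp_all
qed

text \<open>The irreducible divisors of \<open>F\<close> are its nonzero scalar multiples, since the
  units of the ring are constants; hence the hypothesis for every \<open>k\<close>.\<close>

lemma curve_of_irreducible:
  assumes "irreducible F" and "\<And>k. k \<noteq> 0 \<Longrightarrow> dual_real_part (const3 k * F) = S"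
  shows "curve_of F = S"
proof -
  have F: "dual_real_part F = S" using assms(2)[of 1] by (simp add: const3_1)
  have q: "dual_real_part q = S" if "irreducible q" "q dvd F" for q
    using irreducible_dvd_irreducible_poly3[OF assms(1) that] assms(2) by metis
  have "{dual_real_part q | q. irreducible q \<and> q dvd F} = {S}"
  proof (intro subset_antisym subsetI)
    show "T \<in> {S}" if "T \<in> {dual_real_part q | q. irreducible q \<and> q dvd F}" for T
      using that q by auto
    show "T \<in> {dual_real_part q | q. irreducible q \<and> q dvd F}" if "T \<in> {S}" for T
      unfolding mem_Collect_eq by (rule exI[of _ F]) (use that F assms(1) in simp)
  qed
  then show ?thesis by (simp add: curve_of_def)
qed

lemma constant_factor_of_monic_is_unit:
  fixes A B :: "'a::idom poly"
  assumes "lead_coeff (A * B) = 1" "degree A = 0"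
  shows "A dvd 1"
proof -
  obtain x where A: "A = [:x:]" using assms(2) by (rule degree_eq_zeroE)
  then have "x * lead_coeff B = 1" using assms(1) by (simp only: lead_coeff_mult lead_coeff_pCons(2))
  then show ?thesis using A by (metis dvd_triv_left is_unit_poly_iff)
qed

text \<open>Over a mere domain constants need not be units, but a constant factor of a monic
  polynomial is one, by comparing leading coefficients. Only splittings into positive degrees
  remain.\<close>

lemma irreducible_monic_polyI:
  fixes F :: "'a::idom poly"
  assumes "lead_coeff F = 1" "degree F \<noteq> 0"
    and "\<And>A B. F = A * B \<Longrightarrow> degree A \<noteq> 0 \<Longrightarrow> degree B \<noteq> 0 \<Longrightarrow> False"
  shows "irreducible F"
proof (rule irreducibleI)
  show "F \<noteq> 0" using assms(2) by auto
  show "\<not> F dvd 1" using assms(2) by (auto simp: is_unit_poly_iff)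
  show "A dvd 1 \<or> B dvd 1" if "F = A * B" for A B
    using assms(1,3) that constant_factor_of_monic_is_unit[of A B] constant_factor_of_monic_is_unit[of B A]
    by (metis mult.commute)
qed

lemma irreducible_monic_linear_poly:
  fixes s :: "'a::idom"
  shows "irreducible [:s, 1:]"
proof (rule irreducible_monic_polyI)
  fix A B :: "'a poly" assume AB: "[:s, 1:] = A * B" "degree A \<noteq> 0" "degree B \<noteq> 0"
  then have "degree (A * B) = degree A + degree B" by (intro degree_mult_eq) auto
  then show False using AB(2,3) by (simp flip: AB(1))
qed simp_all

definition line_factor :: "complex \<Rightarrow> complex \<Rightarrow> complex \<Rightarrow> poly3" where
  "line_factor c \<alpha> \<beta> = [:[:[:0, c * \<alpha>:], [:c * \<beta>:]:], [:[:c:]:]:]"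

text \<open>As for \<open>line_factor\<close>, the scalar \<open>c\<close> is carried along because
  all associates of a factor must be dualised.\<close>

definition conic_factor :: "complex \<Rightarrow> complex \<Rightarrow> complex \<Rightarrow> complex \<Rightarrow> poly3" where
  "conic_factor c p q r =
     [:[:[:0, 0, - c * p:], [:0, - 2 * c * q:], [:- c * r:]:], 0, [:[:c:]:]:]"

lemma const3_mult_line_factor: "const3 k * line_factor c \<alpha> \<beta> = line_factor (k * c) \<alpha> \<beta>"
  by (simp add: const3_def line_factor_def)

lemma const3_mult_conic_factor: "const3 k * conic_factor c p q r = conic_factor (k * c) p q r"
  by (simp add: const3_def conic_factor_def)

lemma eval3_line_factor: "eval3 (line_factor c \<alpha> \<beta>) u v w = c * (\<alpha> * u + \<beta> * v + w)"
  by (simp add: eval3_def line_factor_def algebra_simps)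

lemma grad3_line_factor: "grad3 (line_factor c \<alpha> \<beta>) (u, v, w) = (c * \<alpha>, c * \<beta>, c)"
  by (simp add: grad3_def eval3_def diffU_def diffV_def diffW_def line_factor_def map_poly_pCons pderiv_pCons)

lemma eval3_conic_factor:
  "eval3 (conic_factor c p q r) u v w = c * (w\<^sup>2 - (p * u\<^sup>2 + 2 * q * u * v + r * v\<^sup>2))"
  by (simp add: eval3_def conic_factor_def power2_eq_square algebra_simps)

lemma grad3_conic_factor:
  "grad3 (conic_factor c p q r) (u, v, w) = (- 2 * c * (p * u + q * v), - 2 * c * (q * u + r * v), 2 * c * w)"
  by (simp add: grad3_def eval3_def diffU_def diffV_def diffW_def conic_factor_def map_poly_pCons pderiv_pCons algebra_simps)

lemma dual_real_part_line_factor: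
  assumes "c \<noteq> 0"
  shows "dual_real_part (line_factor c (of_real \<alpha>) (of_real \<beta>)) = {Complex \<alpha> \<beta>}"
proof -
  let ?\<alpha> = "complex_of_real \<alpha>" and ?\<beta> = "complex_of_real \<beta>"
  let ?C = "{P :: complex \<times> complex \<times> complex. fst P = ?\<alpha> * snd (snd P) \<and> fst (snd P) = ?\<beta> * snd (snd P)}"
  have "closed ?C" by (intro closed_Collect_conj closed_Collect_eq continuous_intros)
  then have "dual_cone (line_factor c ?\<alpha> ?\<beta>) \<subseteq> ?C"
    unfolding dual_cone_def grad3_line_factor by (intro closure_minimal) auto
  \<comment> \<open>The gradient is constant, so any zero serves as base point; (1, 0, - \<alpha>)
    is taken.\<close>
  moreover have "(?\<alpha>, ?\<beta>, 1) \<in> dual_cone (line_factor c ?\<alpha> ?\<beta>)"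
    unfolding dual_cone_def grad3_line_factor eval3_line_factor
    by (rule subsetD[OF closure_subset], unfold mem_Collect_eq,
        rule exI[of _ "1 / c"], rule exI[of _ "c * ?\<alpha>"], rule exI[of _ "c * ?\<beta>"], rule exI[of _ c],
        rule exI[of _ 1], rule exI[of _ 0], rule exI[of _ "- ?\<alpha>"])
       (use assms in simp)
  ultimately show ?thesis
    unfolding dual_real_part_def by (auto simp: complex_eq_iff)
qed

text \<open>Gradients at zeros of the factor satisfy the equation of the adjugate form, a closed
  condition that passes to the closure. Conversely, every real solution is itself a rescaled
  gradient.\<close>

lemma dual_real_part_conic_factor:
  fixes p q r :: real
  assumes c: "c \<noteq> 0" and disc: "p * r \<noteq> q\<^sup>2"
  shows "dual_real_part (conic_factor c (of_real p) (of_real q) (of_real r)) =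
    {z. r * (Re z)\<^sup>2 - 2 * q * Re z * Im z + p * (Im z)\<^sup>2 = p * r - q\<^sup>2}"
proof -
  let ?p = "complex_of_real p" and ?q = "complex_of_real q" and ?r = "complex_of_real r"
  let ?F = "conic_factor c ?p ?q ?r"
  let ?G = "\<lambda>(X, Y, Z). ?r * X\<^sup>2 - 2 * ?q * X * Y + ?p * Y\<^sup>2 - (?p * ?r - ?q\<^sup>2) * Z\<^sup>2"
  have upper: "dual_cone ?F \<subseteq> {P. ?G P = 0}"
    unfolding dual_cone_def
  proof (rule closure_minimal)
    show "closed {P. ?G P = 0}"
      unfolding case_prod_beta by (intro closed_Collect_eq continuous_intros)
    have "?G (k * X, k * Y, k * Z) = 0"
      if "eval3 ?F u v w = 0" and "grad3 ?F (u, v, w) = (X, Y, Z)" for k X Y Z u v w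
    proof -
      have w: "w\<^sup>2 = ?p * u\<^sup>2 + 2 * ?q * u * v + ?r * v\<^sup>2"
        and X: "X = - 2 * c * (?p * u + ?q * v)" and Y: "Y = - 2 * c * (?q * u + ?r * v)" and Z: "Z = 2 * c * w"
        using c that by (auto simp: eval3_conic_factor grad3_conic_factor)
      have Z2: "(k * Z)\<^sup>2 = 4 * k\<^sup>2 * c\<^sup>2 * w\<^sup>2" by (simp add: Z power_mult_distrib)
      show ?thesis
        unfolding prod.case Z2 w by (simp add: X Y power2_eq_square algebra_simps)
    qed
    then show "{(k * X, k * Y, k * Z) | k X Y Z u v w. k \<noteq> 0 \<and> (u, v, w) \<noteq> (0, 0, 0) \<and> eval3 ?F u v w = 0
      \<and> grad3 ?F (u, v, w) = (X, Y, Z) \<and> (X, Y, Z) \<noteq> (0, 0, 0)} \<subseteq> {P. ?G P = 0}"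
      by blast
  qed
  have attained: "(of_real x, of_real y, 1) \<in> dual_cone ?F"
    if eq: "r * x\<^sup>2 - 2 * q * x * y + p * y\<^sup>2 = p * r - q\<^sup>2" for x y
  proof -
    define \<delta> where "\<delta> = p * r - q\<^sup>2"
    have \<delta>: "\<delta> \<noteq> 0" using disc by (simp add: \<delta>_def)
    \<comment> \<open>Cramer's rule for p u + q v = x, q u + r v = y.\<close>
    define u v where "u = (r * x - q * y) / \<delta>" and "v = (p * y - q * x) / \<delta>"
    have "\<delta> * (p * u + q * v) = \<delta> * x" "\<delta> * (q * u + r * v) = \<delta> * y"
      using \<delta> by (simp_all add: u_def v_def distrib_left)
        (simp_all add: \<delta>_def power2_eq_square algebra_simps)
    then have xy: "p * u + q * v = x" "q * u + r * v = y" using \<delta> by simp_all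
    have "p * u\<^sup>2 + 2 * q * u * v + r * v\<^sup>2 = u * (p * u + q * v) + v * (q * u + r * v)"
      by (simp add: power2_eq_square algebra_simps)
    also have "\<dots> = (r * x\<^sup>2 - 2 * q * x * y + p * y\<^sup>2) / \<delta>"
      unfolding xy by (simp add: u_def v_def power2_eq_square diff_divide_distrib add_divide_distrib algebra_simps)
    also have "\<dots> = 1" using eq \<delta> by (simp add: \<delta>_def)
    finally have on: "p * u\<^sup>2 + 2 * q * u * v + r * v\<^sup>2 = 1" .
    have xy': "?p * of_real u + ?q * of_real v = of_real x" "?q * of_real u + ?r * of_real v = of_real y"
      by (simp_all flip: xy)
    have "?p * (of_real u)\<^sup>2 + 2 * ?q * of_real u * of_real v + ?r * (of_real v)\<^sup>2 = 1"
      using arg_cong[OF on, of complex_of_real] by simp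
    \<comment> \<open>With w = -1 the gradient is - 2 c (x, y, 1).\<close>
    then have "eval3 ?F (of_real u) (of_real v) (- 1) = 0"
      by (simp add: eval3_conic_factor)
    moreover have "grad3 ?F (of_real u, of_real v, - 1) = (- 2 * c * of_real x, - 2 * c * of_real y, - 2 * c)"
      unfolding grad3_conic_factor xy' by simp
    ultimately show ?thesis
      unfolding dual_cone_def
      by (intro subsetD[OF closure_subset], unfold mem_Collect_eq)
        (rule exI[of _ "- 1 / (2 * c)"], rule exI[of _ "- 2 * c * of_real x"], rule exI[of _ "- 2 * c * of_real y"],
         rule exI[of _ "- 2 * c"], rule exI[of _ "of_real u"], rule exI[of _ "of_real v"], rule exI[of _ "- 1"],
         use c in simp)
  qed
  have "r * x\<^sup>2 - 2 * q * x * y + p * y\<^sup>2 = p * r - q\<^sup>2" if "(of_real x, of_real y, 1) \<in> dual_cone ?F" for x y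
  proof -
    have "?G (of_real x, of_real y, 1) = 0" using subsetD[OF upper that] by (rule CollectD)
    then have "complex_of_real (r * x\<^sup>2 - 2 * q * x * y + p * y\<^sup>2 - (p * r - q\<^sup>2)) = 0"
      unfolding prod.case by simp
    then show ?thesis unfolding of_real_eq_0_iff by simp
  qed
  then show ?thesis
    unfolding dual_real_part_def using attained by (intro Collect_cong iffI)
qed

text \<open>A splitting must be linear in \<open>w\<close> on both sides, which would make the
  quadratic form in \<open>u\<close>, \<open>v\<close> a square and its discriminant zero.\<close>

lemma irreducible_conic_factor:
  assumes "p * r \<noteq> q\<^sup>2"
  shows "irreducible (conic_factor 1 p q r)"
proof (rule irreducible_monic_polyI)
  let ?F = "conic_factor 1 p q r"
  let ?Q = "[:[:0, 0, p:], [:0, 2 * q:], [:r:]:]"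
  have deg: "degree ?F = 2" by (simp add: conic_factor_def)
  then show "degree ?F \<noteq> 0" by simp
  show "lead_coeff ?F = 1" by (simp add: conic_factor_def one_pCons)
  fix A B assume AB: "?F = A * B" "degree A \<noteq> 0" "degree B \<noteq> 0"
  then have "degree (A * B) = degree A + degree B" by (intro degree_mult_eq) auto
  with AB deg have "degree A = 1" "degree B = 1" by auto
  then obtain a0 a1 b0 b1 where A: "A = [:a0, a1:]" and B: "B = [:b0, b1:]"
    by (metis degree1_coeffs)
  have coeffs: "a0 * b0 = - ?Q" "a0 * b1 + a1 * b0 = 0" "a1 * b1 = 1"
    using AB(1) by (simp_all add: A B conic_factor_def one_pCons algebra_simps)
  \<comment> \<open>Since the coefficient of \<open>w\<close> vanishes, \<open>s\<close> and a1 b0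
    are opposite, and s^2 is the quadratic form itself.\<close>
  define s where "s = a0 * b1"
  have "a0 * b1 = - (a1 * b0)" using coeffs(2) by (simp add: eq_neg_iff_add_eq_0)
  then have "s * s = a0 * b1 * - (a1 * b0)" by (simp add: s_def)
  also have "\<dots> = - (a0 * b0) * (a1 * b1)" by (simp add: mult_ac)
  also have "\<dots> = ?Q" unfolding coeffs by simp
  finally have s: "s * s = ?Q" .
  have "degree ?Q \<le> 2" by (simp add: degree_pCons_le)
  then have "degree s \<le> 1"
    using degree_mult_eq[of s s] s by (cases "s = 0") auto
  then have "s = [:coeff s 0, coeff s 1:]"
    by (intro poly_eqI) (auto simp: coeff_pCons coeff_eq_0 split: nat.splits)
  then obtain s0 s1 where "s = [:s0, s1:]" by blast
  then have "s0 * s0 = [:0, 0, p:]" "2 * (s0 * s1) = [:0, 2 * q:]" "s1 * s1 = [:r:]"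
    using s by (auto simp: algebra_simps)
  \<comment> \<open>Eliminates \<open>s0\<close> and \<open>s1\<close>; the coefficient of u^2 then
    reads q^2 = p r.\<close>
  moreover have "(2 * (s0 * s1)) * (2 * (s0 * s1)) = 4 * ((s0 * s0) * (s1 * s1))" by (simp add: mult_ac)
  ultimately have "[:0, 2 * q:] * [:0, 2 * q:] = 4 * ([:0, 0, p:] * [:r:])" by simp
  then have "coeff ([:0, 2 * q:] * [:0, 2 * q:]) 2 = coeff (4 * ([:0, 0, p:] * [:r:])) 2" by (rule arg_cong)
  then show False using assms by (simp add: numeral_poly power2_eq_square numeral_2_eq_2 mult.commute)
qed

section \<open>The boundary generating curve\<close>

lemma diagonal_matrix_conjugation:
  "(diagonal_matrix d ** B ** diagonal_matrix d) $ i $ j = d $ i * B $ i $ j * d $ j"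
  by (simp add: matrix_matrix_mult_def diagonal_matrix_def if_distrib if_distribR sum.delta sum.delta' cong: if_cong)

lemma krein_adjoint_signature5:
  "krein_adjoint signature5 B $ i $ j
   = vector [1, -1, 1, -1, 1] $ i * cnj (B $ j $ i) * vector [1, -1, 1, -1, 1] $ j"
  unfolding krein_adjoint_def signature5_def diagonal_matrix_conjugation by (simp add: conj_transpose_def)

text \<open>The off-diagonal entry with \<open>x\<close> in its place and \<open>y\<close> in the
  transposed one. Neighbouring signs of \<open>J\<close> differ, so the adjoint contributes
  \<open>- cnj y\<close>.\<close>

definition line_entry :: "complex \<Rightarrow> complex \<Rightarrow> poly3" where
  "line_entry x y = varU * const3 ((x - cnj y) / 2) + varV * const3 ((x + cnj y) / (2 * \<i>))"

lemma const3_0: "const3 0 = 0"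
  by (simp add: const3_def)

text \<open>By the flip symmetry the products of opposite off-diagonal entries are P, R, R, P, which
  makes the tridiagonal determinant factor.\<close>

lemma line_polynomial_tridiagonal5_aux:
  fixes a :: real and b1 b2 b3 b4 :: complex
  defines "\<alpha> \<equiv> varU * const3 (of_real a) + varW" and "\<delta> \<equiv> varU * const3 (- of_real a) + varW"
  defines "P \<equiv> line_entry b1 b4 * line_entry b4 b1" and "R \<equiv> line_entry b2 b3 * line_entry b3 b2"
  shows "line_polynomial signature5 (tridiagonal5 a b1 b2 b3 b4) = \<alpha> * (\<alpha> * \<delta> - P) * (\<alpha> * \<delta> - P - 2 * R)"
proof -
  let ?A = "tridiagonal5 a b1 b2 b3 b4"
  let ?H = "krein_Re signature5 ?A" and ?K = "krein_Im signature5 ?A"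
  define L :: "poly3^5^5" where
    "L = (\<chi> i j. varU * const3 (?H $ i $ j) + varV * const3 (?K $ i $ j) + (if i = j then varW else 0))"
  have L: "L $ i $ j = varU * const3 (?H $ i $ j) + varV * const3 (?K $ i $ j) + (if i = j then varW else 0)" for i j
    by (simp add: L_def)
  note entry = L krein_Re_def krein_Im_def krein_adjoint_signature5 tridiagonal5_def vector_5
  have zero: "L$1$3 = 0" "L$1$4 = 0" "L$1$5 = 0" "L$2$4 = 0" "L$2$5 = 0" "L$3$5 = 0"
    "L$3$1 = 0" "L$4$1 = 0" "L$5$1 = 0" "L$4$2 = 0" "L$5$2 = 0" "L$5$3 = 0"
    by (simp_all add: entry const3_0)
  have diag: "L$1$1 = \<alpha>" "L$2$2 = \<delta>" "L$3$3 = \<alpha>" "L$4$4 = \<delta>" "L$5$5 = \<alpha>"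
    by (simp_all add: entry const3_0 \<alpha>_def \<delta>_def)
  have off: "L$1$2 = line_entry b1 b4" "L$2$1 = line_entry b4 b1" "L$2$3 = line_entry b2 b3" "L$3$2 = line_entry b3 b2"
    "L$3$4 = line_entry b3 b2" "L$4$3 = line_entry b2 b3" "L$4$5 = line_entry b4 b1" "L$5$4 = line_entry b1 b4"
    by (simp_all add: entry line_entry_def)
  have "det L = \<alpha> * (\<alpha> * \<delta> - P) * (\<alpha> * \<delta> - P - 2 * R)"
    unfolding det_tridiagonal_5[OF zero] diag off P_def R_def by (simp add: algebra_simps)
  then show ?thesis unfolding line_polynomial_def L_def .
qed

text \<open>For real \<open>u\<close>, \<open>v\<close> the two entries are negative conjugates of
  each other; hence the real coefficients.\<close>

lemma line_entry_mult:
  "line_entry x y * line_entry y x =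
   [:[:[:0, 0, of_real ((2 * Re (x * y) - (cmod x)\<^sup>2 - (cmod y)\<^sup>2) / 4):],
      [:0, of_real (Im (x * y)):],
      [:of_real (- (2 * Re (x * y) + (cmod x)\<^sup>2 + (cmod y)\<^sup>2) / 4):]:]:]"
proof -
  have entry: "line_entry x y = [:[:[:0, (x - cnj y) / 2:], [:(x + cnj y) / (2 * \<i>):]:]:]" for x y
    by (simp add: line_entry_def varU_def varV_def const3_def)
  have "(x - cnj y) / 2 * ((y - cnj x) / 2) = of_real ((2 * Re (x * y) - (cmod x)\<^sup>2 - (cmod y)\<^sup>2) / 4)"
    unfolding cmod_power2 by (simp add: complex_eq_iff power2_eq_square field_simps)
  moreover have "(x + cnj y) / (2 * \<i>) * ((y + cnj x) / (2 * \<i>)) = of_real (- (2 * Re (x * y) + (cmod x)\<^sup>2 + (cmod y)\<^sup>2) / 4)"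
    unfolding cmod_power2 by (simp add: complex_eq_iff power2_eq_square field_simps)
  moreover have "(x - cnj y) / 2 * ((y + cnj x) / (2 * \<i>)) + (x + cnj y) / (2 * \<i>) * ((y - cnj x) / 2) = of_real (Im (x * y))"
  proof -
    have "(x - cnj y) / 2 * ((y + cnj x) / (2 * \<i>)) + (x + cnj y) / (2 * \<i>) * ((y - cnj x) / 2)
      = (x * y - cnj (x * y)) / (2 * \<i>)"
      by (simp add: field_simps)
    also have "\<dots> = of_real (Im (x * y))"
    proof -
      have "of_real (2 * t) * \<i> / (2 * \<i>) = complex_of_real t" for t
        by (subst nonzero_divide_eq_eq) simp_all
      then show ?thesis unfolding complex_diff_cnj .
    qed
    finally show ?thesis .
  qed
  ultimately show ?thesis
    unfolding entry by (simp add: algebra_simps)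
qed

definition focal_conic_factor :: "complex \<Rightarrow> real \<Rightarrow> poly3" where
  "focal_conic_factor D M = conic_factor 1 (of_real (M / 4 + Re D / 2)) (of_real (Im D / 2)) (of_real (M / 4 - Re D / 2))"

text \<open>The product of the two diagonal entries is w^2 - a^2 u^2. Its a^2 is shared equally by M
  / 4 and Re D / 2, and cancels in the coefficient of v^2.\<close>

lemma line_polynomial_tridiagonal5:
  fixes a :: real and b1 b2 b3 b4 :: complex
  defines "M1 \<equiv> 2 * a\<^sup>2 - (cmod b1)\<^sup>2 - (cmod b4)\<^sup>2" and "D1 \<equiv> (complex_of_real a)\<^sup>2 + b1 * b4"
  shows "line_polynomial signature5 (tridiagonal5 a b1 b2 b3 b4) =
    line_factor 1 (of_real a) (of_real 0) * focal_conic_factor D1 M1 *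
    focal_conic_factor (D1 + 2 * b2 * b3) (M1 - 2 * (cmod b2)\<^sup>2 - 2 * (cmod b3)\<^sup>2)"
proof -
  let ?\<alpha> = "varU * const3 (of_real a) + varW" and ?\<delta> = "varU * const3 (- of_real a) + varW"
  have \<alpha>: "?\<alpha> = line_factor 1 (of_real a) (of_real 0)"
    by (simp add: varU_def varW_def const3_def line_factor_def one_pCons)
  have "?\<alpha> * ?\<delta> = [:[:[:0, 0, - of_real (a\<^sup>2):]:], 0, 1:]"
    by (simp add: varU_def varW_def const3_def one_pCons power2_eq_square)
  then have "?\<alpha> * ?\<delta> - line_entry b1 b4 * line_entry b4 b1 = focal_conic_factor D1 M1"
    and "?\<alpha> * ?\<delta> - line_entry b1 b4 * line_entry b4 b1 - 2 * (line_entry b2 b3 * line_entry b3 b2)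
      = focal_conic_factor (D1 + 2 * b2 * b3) (M1 - 2 * (cmod b2)\<^sup>2 - 2 * (cmod b3)\<^sup>2)"
    unfolding line_entry_mult focal_conic_factor_def conic_factor_def M1_def D1_def
    by (simp_all add: numeral_poly one_pCons field_simps complex_eq_iff power2_eq_square)
  then show ?thesis
    unfolding line_polynomial_tridiagonal5_aux \<alpha> by simp
qed

lemma curve_of_line_factor: "curve_of (line_factor 1 (of_real \<alpha>) (of_real \<beta>)) = {Complex \<alpha> \<beta>}"
proof (rule curve_of_irreducible)
  have "line_factor 1 (of_real \<alpha>) (of_real \<beta>) = [:[:[:0, of_real \<alpha>:], [:of_real \<beta>:]:], 1:]"
    by (simp add: line_factor_def one_pCons)
  then show "irreducible (line_factor 1 (of_real \<alpha>) (of_real \<beta>))"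
    by (simp only: irreducible_monic_linear_poly)
  show "dual_real_part (const3 k * line_factor 1 (of_real \<alpha>) (of_real \<beta>)) = {Complex \<alpha> \<beta>}" if "k \<noteq> 0" for k
    unfolding const3_mult_line_factor using that by (simp add: dual_real_part_line_factor)
qed

text \<open>The bound on \<open>M\<close> makes the discriminant nonzero, giving irreducibility; the
  dual equation is the focal equation divided by -16.\<close>

lemma curve_of_focal_conic_factor:
  assumes f: "f\<^sup>2 = D" and M: "\<bar>M\<bar> < 2 * cmod D"
  shows "curve_of (focal_conic_factor D M) = hyperbola f (- f) (sqrt (2 * cmod D - M))"
proof -
  let ?p = "M / 4 + Re D / 2" and ?q = "Im D / 2" and ?r = "M / 4 - Re D / 2"
  have disc: "4 * (cmod D)\<^sup>2 - M\<^sup>2 = - 16 * (?p * ?r - ?q\<^sup>2)"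
    unfolding cmod_power2 by (simp add: power2_eq_square algebra_simps)
  have "M\<^sup>2 < (2 * cmod D)\<^sup>2"
    using power_strict_mono[OF M, of 2] by simp
  then have "?p * ?r - ?q\<^sup>2 < 0" using disc by (simp add: power_mult_distrib)
  then have pr: "?p * ?r \<noteq> ?q\<^sup>2" by simp
  then have pr': "complex_of_real ?p * complex_of_real ?r \<noteq> (complex_of_real ?q)\<^sup>2"
    by (metis of_real_eq_iff of_real_mult of_real_power)
  have "focal_form D M z = - 16 * (?r * (Re z)\<^sup>2 - 2 * ?q * Re z * Im z + ?p * (Im z)\<^sup>2)" for z
    unfolding focal_form_def cmod_power2 by (simp add: power2_eq_square algebra_simps)
  then have "focal_form D M z = 4 * (cmod D)\<^sup>2 - M\<^sup>2 \<longleftrightarrow>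
    ?r * (Re z)\<^sup>2 - 2 * ?q * Re z * Im z + ?p * (Im z)\<^sup>2 = ?p * ?r - ?q\<^sup>2" for z
    unfolding disc by (simp only: mult_cancel_left) simp
  then have "hyperbola f (- f) (sqrt (2 * cmod D - M)) =
    {z. ?r * (Re z)\<^sup>2 - 2 * ?q * Re z * Im z + ?p * (Im z)\<^sup>2 = ?p * ?r - ?q\<^sup>2}"
    unfolding hyperbola_eq_conic[OF f M] by simp
  then show ?thesis
    unfolding focal_conic_factor_def
    by (intro curve_of_irreducible irreducible_conic_factor[OF pr'])
       (simp only: const3_mult_conic_factor mult_1_right dual_real_part_conic_factor[OF _ pr] not_False_eq_True)
qed

text \<open>Here the quadratic form is the square of Re f u + Im f v, so the factor splits into the
  lines dual to the points f and - f.\<close>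

lemma focal_conic_factor_degenerate:
  assumes f: "f\<^sup>2 = D" and M: "M = 2 * cmod D"
  shows "focal_conic_factor D M =
    line_factor 1 (of_real (Re f)) (of_real (Im f)) * line_factor 1 (of_real (- Re f)) (of_real (- Im f))"
proof -
  have "cmod D = (Re f)\<^sup>2 + (Im f)\<^sup>2" using f cmod_power2 by (metis norm_power)
  moreover have "Re D = (Re f)\<^sup>2 - (Im f)\<^sup>2" "Im D = 2 * Re f * Im f"
    unfolding f[symmetric] by (simp_all add: power2_eq_square)
  ultimately have "M / 4 + Re D / 2 = (Re f)\<^sup>2" "Im D / 2 = Re f * Im f" "M / 4 - Re D / 2 = (Im f)\<^sup>2"
    unfolding M by (simp_all add: field_simps)
  then show ?thesis
    unfolding focal_conic_factor_def
    by (simp add: conic_factor_def line_factor_def power2_eq_square)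
qed

section \<open>Assembly: the range, the two hyperbolas and the isolated point\<close>

theorem theorem3p2:
  fixes a :: real and b1 b2 b3 b4 :: complex
    and J A :: "complex ^ 5 ^ 5"
    and \<Delta>1 \<Delta>2 :: complex and M1 M2 :: real
  assumes J: "J = diagonal_matrix (vector [1, -1, 1, -1, 1])"
    and A: "A = vector
      [vector [complex_of_real a, b1, 0, 0, 0],
       vector [b4, - complex_of_real a, b2, 0, 0],
       vector [0, b3, complex_of_real a, b3, 0],
       vector [0, 0, b2, - complex_of_real a, b4],
       vector [0, 0, 0, b1, complex_of_real a]]"
    and \<Delta>1: "\<Delta>1 = (complex_of_real a)\<^sup>2 + b1 * b4"
    and M1: "M1 = 2 * a\<^sup>2 - (cmod b1)\<^sup>2 - (cmod b4)\<^sup>2"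
    and \<Delta>2: "\<Delta>2 = \<Delta>1 + 2 * b2 * b3"
    and M2: "M2 = M1 - 2 * (cmod b2)\<^sup>2 - 2 * (cmod b3)\<^sup>2"
  shows "(bounded_by_hyperbola (krein_range J A)
            (csqrt \<Delta>2) (- csqrt \<Delta>2) (sqrt (2 * cmod \<Delta>2 - M2))
          \<longleftrightarrow> \<bar>M2\<bar> < 2 * cmod \<Delta>2)
       \<and> (\<bar>M2\<bar> < 2 * cmod \<Delta>2 \<longrightarrow>
            boundary_generating_curve J A =
              {complex_of_real a}
              \<union> hyperbola (csqrt \<Delta>1) (- csqrt \<Delta>1) (sqrt (2 * cmod \<Delta>1 - M1))
              \<union> hyperbola (csqrt \<Delta>2) (- csqrt \<Delta>2) (sqrt (2 * cmod \<Delta>2 - M2))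
            \<and> (nondegenerate_hyperbola (csqrt \<Delta>1) (- csqrt \<Delta>1) (sqrt (2 * cmod \<Delta>1 - M1))
               \<or> degenerate_hyperbola (csqrt \<Delta>1) (- csqrt \<Delta>1) (sqrt (2 * cmod \<Delta>1 - M1))))"
proof (intro conjI impI)
  have JA: "J = signature5" "A = tridiagonal5 a b1 b2 b3 b4"
    unfolding J A signature5_def tridiagonal5_def by (rule refl)+
  note nondeg = nondegenerate_hyperbola_iff[OF power2_csqrt]
  have range: "krein_range J A = hyperbolic_disc (csqrt \<Delta>2) (- csqrt \<Delta>2) (sqrt (2 * cmod \<Delta>2 - M2))"
    if "\<bar>M2\<bar> < 2 * cmod \<Delta>2"
    unfolding JA hyperbolic_disc_eq[OF power2_csqrt that]
    by (rule krein_range_eq_focal_region) (use that in \<open>simp_all add: \<Delta>1 \<Delta>2 M1 M2\<close>)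
  \<comment> \<open>The direction to the inequality uses only the nondegeneracy contained in being
    bounded by the hyperbola.\<close>
  then show "bounded_by_hyperbola (krein_range J A)
      (csqrt \<Delta>2) (- csqrt \<Delta>2) (sqrt (2 * cmod \<Delta>2 - M2)) \<longleftrightarrow> \<bar>M2\<bar> < 2 * cmod \<Delta>2"
    unfolding bounded_by_hyperbola_def nondeg by blast
  assume H2: "\<bar>M2\<bar> < 2 * cmod \<Delta>2"
  \<comment> \<open>This holds for all parameters, by 2 |b1 b4| \<le> |b1|^2 + |b4|^2.\<close>
  have upper: "M1 \<le> 2 * cmod \<Delta>1"
  proof -
    have "a\<^sup>2 - cmod (b1 * b4) \<le> cmod \<Delta>1"
      using norm_diff_ineq[of "(complex_of_real a)\<^sup>2" "b1 * b4"] by (simp add: \<Delta>1 norm_power)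
    moreover have "2 * cmod (b1 * b4) \<le> (cmod b1)\<^sup>2 + (cmod b4)\<^sup>2"
      using sum_squares_bound[of "cmod b1" "cmod b4"] by (simp add: norm_mult)
    ultimately show ?thesis by (simp add: M1)
  qed
  \<comment> \<open>Likewise 2 |b2 b3| \<le> |b2|^2 + |b3|^2 gives 2 |\<Delta>2| + M2 \<le> 2
    |\<Delta>1| + M1, so strictness is inherited from the second hyperbola. In the case of equality
    in \<open>upper\<close> it keeps the two foci distinct.\<close>
  have lower: "- M1 < 2 * cmod \<Delta>1"
  proof -
    have "cmod \<Delta>2 \<le> cmod \<Delta>1 + 2 * (cmod b2 * cmod b3)"
      using norm_triangle_ineq[of \<Delta>1 "2 * b2 * b3"] by (simp add: \<Delta>2 norm_mult)
    moreover have "2 * (cmod b2 * cmod b3) \<le> (cmod b2)\<^sup>2 + (cmod b3)\<^sup>2"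
      using sum_squares_bound[of "cmod b2" "cmod b3"] by simp
    ultimately show ?thesis using H2 M2 by linarith
  qed
  show "nondegenerate_hyperbola (csqrt \<Delta>1) (- csqrt \<Delta>1) (sqrt (2 * cmod \<Delta>1 - M1))
      \<or> degenerate_hyperbola (csqrt \<Delta>1) (- csqrt \<Delta>1) (sqrt (2 * cmod \<Delta>1 - M1))"
  proof (cases "M1 = 2 * cmod \<Delta>1")
    case True
    then have "\<Delta>1 \<noteq> 0" using lower by auto
    then show ?thesis using True by (simp add: degenerate_hyperbola_def)
  next
    case False
    then have "\<bar>M1\<bar> < 2 * cmod \<Delta>1" using upper lower by linarith
    then show ?thesis by (simp add: nondeg)
  qed
  have "curve_of (focal_conic_factor \<Delta>1 M1) = hyperbola (csqrt \<Delta>1) (- csqrt \<Delta>1) (sqrt (2 * cmod \<Delta>1 - M1))"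
  proof (cases "M1 = 2 * cmod \<Delta>1")
    case True
    then show ?thesis
      unfolding focal_conic_factor_degenerate[OF power2_csqrt True] curve_of_mult curve_of_line_factor
      by (auto simp: hyperbola_def complex_eq_iff)
  next
    case False
    then have "\<bar>M1\<bar> < 2 * cmod \<Delta>1" using upper lower by linarith
    then show ?thesis by (rule curve_of_focal_conic_factor[OF power2_csqrt])
  qed
  moreover have "boundary_generating_curve J A = curve_of (line_polynomial J A)"
    by (simp add: boundary_generating_curve_def curve_of_def)
  moreover have "line_polynomial J A = line_factor 1 (of_real a) (of_real 0) * focal_conic_factor \<Delta>1 M1 * focal_conic_factor \<Delta>2 M2"
    unfolding JA line_polynomial_tridiagonal5 \<Delta>1 \<Delta>2 M1 M2 by (rule refl)
  moreover have "Complex a 0 = of_real a" by (simp add: complex_of_real_def)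
  ultimately show "boundary_generating_curve J A =
        {complex_of_real a}
        \<union> hyperbola (csqrt \<Delta>1) (- csqrt \<Delta>1) (sqrt (2 * cmod \<Delta>1 - M1))
        \<union> hyperbola (csqrt \<Delta>2) (- csqrt \<Delta>2) (sqrt (2 * cmod \<Delta>2 - M2))"
    unfolding curve_of_focal_conic_factor[OF power2_csqrt H2, symmetric]
    by (simp only: curve_of_mult curve_of_line_factor)
qed

end
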